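(* The FSR IRREDUCIBILITY problem is NP-hard: the (NP-complete) CIRCUIT SATISFIABILITY problem is polynomial-time Karp reducible to the problem whose instances are feedback shift registers $f$, given by their feedback logic $f_1$ as a Boolean circuit (input size $|f_1|$), and whose question is "Is $f$ irreducible?".
   Context: A Boolean circuit with $m$ inputs is a directed acyclic graph with $m$ sources (the inputs) and one sink (the output), each non-source vertex being a gate AND or OR (fan-in 2) or NOT (fan-in 1); its size $|f|$ is its number of vertices. It is satisfiable if some input makes it output 1. CIRCUIT SATISFIABILITY: given a Boolean circuit, decide whether it is satisfiable. An $n$-stage feedback shift register (FSR) with feedback logic $f_1:\{0,1\}^n\to\{0,1\}$ has state $(x_0,\dots,x_{n-1})$ updated by $(x_0,\dots,x_{n-1})\mapsto(x_1,\dots,x_{n-1},f_1(x_0,\dots,x_{n-1}))$; its characteristic function is $f(x_0,\dots,x_n)=x_n\oplus f_1(x_0,\dots,x_{n-1})$ and the FSR is also denoted $f$. The set of sequences generated by $f$ is $S(f)=\{s\in\{0,1\}^{\mathbb N}: f(s(t),s(t+1),\dots,s(t+n))=0 \text{ for all } t\}$. If there is an $m$-stage FSR $g$ with $m<n$ and $S(g)\subseteq S(f)$, then $g$ is a subFSR of $f$ and $f$ is reducible; otherwise $f$ is irreducible. A decision problem $P$ is polynomial-time Karp reducible to $Q$ if there is a polynomial-time computable map $T$ from instances of $P$ to instances of $Q$ such that $x$ is a yes-instance of $P$ iff $T(x)$ is a yes-instance of $Q$. A problem is NP-hard if an NP-complete problem is polynomial-time Karp reducible to it. *)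

theory Defs
  imports Main
begin

text \<open>A circuit with m inputs is given by m and a list of gates in topological order.
Vertices 0..m-1 are the inputs (sources); vertex m+i is the i-th gate, whose operands
must be earlier vertices (so the graph is acyclic). The output (sink) is the last vertex.\<close>

datatype gate = AND nat nat | OR nat nat | NOT nat

type_synonym circuit = "nat \<times> gate list"

fun gate_args :: "gate \<Rightarrow> nat list" where
  "gate_args (AND a b) = [a, b]"
| "gate_args (OR a b) = [a, b]"
| "gate_args (NOT a) = [a]"

definition circ_size :: "circuit \<Rightarrow> nat" where
  "circ_size C = fst C + length (snd C)"

text \<open>Well-formed: at least one input, operands refer to earlier vertices,
and the last vertex is the unique sink (every other vertex feeds some gate).\<close>
definition circ_wf :: "circuit \<Rightarrow> bool" where
  "circ_wf C \<longleftrightarrow> (let m = fst C; gs = snd C in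
     1 \<le> m \<and>
     (\<forall>i < length gs. \<forall>a \<in> set (gate_args (gs ! i)). a < m + i) \<and>
     (\<forall>v < m + length gs - 1. \<exists>i < length gs. v \<in> set (gate_args (gs ! i))))"

fun gate_val :: "gate \<Rightarrow> bool list \<Rightarrow> bool" where
  "gate_val (AND a b) vs = (vs ! a \<and> vs ! b)"
| "gate_val (OR a b) vs = (vs ! a \<or> vs ! b)"
| "gate_val (NOT a) vs = (\<not> vs ! a)"

definition circ_eval :: "circuit \<Rightarrow> bool list \<Rightarrow> bool" where
  "circ_eval C xs = last (fold (\<lambda>g vs. vs @ [gate_val g vs]) (snd C) xs)"

definition circ_satisfiable :: "circuit \<Rightarrow> bool" where
  "circ_satisfiable C \<longleftrightarrow> (\<exists>xs. length xs = fst C \<and> circ_eval C xs)"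

text \<open>An n-stage FSR with feedback logic F (a function on bit vectors of length n,
represented as bool lists). Characteristic function f(x_0..x_n) = x_n xor F(x_0..x_{n-1}).\<close>
definition fsr_char :: "nat \<Rightarrow> (bool list \<Rightarrow> bool) \<Rightarrow> bool list \<Rightarrow> bool" where
  "fsr_char n F xs = (xs ! n \<noteq> F (take n xs))"

definition fsr_seqs :: "nat \<Rightarrow> (bool list \<Rightarrow> bool) \<Rightarrow> (nat \<Rightarrow> bool) set" where
  "fsr_seqs n F = {s. \<forall>t. fsr_char n F (map s [t..<t + n + 1]) = False}"

definition fsr_reducible :: "nat \<Rightarrow> (bool list \<Rightarrow> bool) \<Rightarrow> bool" where
  "fsr_reducible n F \<longleftrightarrow> (\<exists>m G. 1 \<le> m \<and> m < n \<and> fsr_seqs m G \<subseteq> fsr_seqs n F)"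

definition fsr_irreducible :: "nat \<Rightarrow> (bool list \<Rightarrow> bool) \<Rightarrow> bool" where
  "fsr_irreducible n F \<longleftrightarrow> \<not> fsr_reducible n F"

definition enc_nat :: "nat \<Rightarrow> bool list" where
  "enc_nat k = replicate k True @ [False]"

fun enc_gate :: "gate \<Rightarrow> bool list" where
  "enc_gate (AND a b) = [False, False] @ enc_nat a @ enc_nat b"
| "enc_gate (OR a b) = [False, True] @ enc_nat a @ enc_nat b"
| "enc_gate (NOT a) = [True, False] @ enc_nat a"

definition enc_circuit :: "circuit \<Rightarrow> bool list" where
  "enc_circuit C = enc_nat (fst C) @ concat (map enc_gate (snd C)) @ [True, True]"

definition CIRCUIT_SAT :: "bool list set" where
  "CIRCUIT_SAT = {enc_circuit C | C. circ_wf C \<and> circ_satisfiable C}"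

definition FSR_IRREDUCIBILITY :: "bool list set" where
  "FSR_IRREDUCIBILITY = {enc_circuit C | C. circ_wf C \<and> fsr_irreducible (fst C) (circ_eval C)}"

datatype sym = Bl | B0 | B1
datatype dir = Lft | Rgt | Stay

text \<open>A machine is (Q, delta): working states 0..Q-1, start state 0, halting state Q.\<close>
type_synonym tm = "nat \<times> (nat \<Rightarrow> sym \<Rightarrow> nat \<times> sym \<times> dir)"

definition tm_wf :: "tm \<Rightarrow> bool" where
  "tm_wf M \<longleftrightarrow> (\<forall>q < fst M. \<forall>a. fst (snd M q a) \<le> fst M)"

text \<open>Configuration: state, tape left of head (reversed), tape from head rightwards.\<close>
type_synonym config = "nat \<times> sym list \<times> sym list"

definition tm_step :: "tm \<Rightarrow> config \<Rightarrow> config" where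
  "tm_step M c = (case c of (q, L, R) \<Rightarrow>
     if q = fst M then c else
     (let a = (case R of [] \<Rightarrow> Bl | x # _ \<Rightarrow> x);
          (q', b, d) = snd M q a;
          R' = b # tl R
      in case d of
          Lft \<Rightarrow> (case L of [] \<Rightarrow> (q', [], Bl # R') | y # L' \<Rightarrow> (q', L', y # R'))
        | Rgt \<Rightarrow> (q', b # L, tl R)
        | Stay \<Rightarrow> (q', L, R')))"

definition bit_sym :: "bool \<Rightarrow> sym" where
  "bit_sym x = (if x then B1 else B0)"

definition tm_run :: "tm \<Rightarrow> nat \<Rightarrow> bool list \<Rightarrow> config" where
  "tm_run M k x = (tm_step M ^^ k) (0, [], map bit_sym x)"

definition tm_output :: "config \<Rightarrow> bool list" where
  "tm_output c = map (\<lambda>a. a = B1) (takeWhile (\<lambda>a. a \<noteq> Bl) (snd (snd c)))"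

definition poly_time_computable :: "(bool list \<Rightarrow> bool list) \<Rightarrow> bool" where
  "poly_time_computable T \<longleftrightarrow>
     (\<exists>M c d. tm_wf M \<and> (\<forall>x. \<exists>k. k \<le> c * length x ^ d + c \<and>
        fst (tm_run M k x) = fst M \<and> tm_output (tm_run M k x) = T x))"

definition karp_reducible :: "bool list set \<Rightarrow> bool list set \<Rightarrow> bool" where
  "karp_reducible A B \<longleftrightarrow> (\<exists>T. poly_time_computable T \<and> (\<forall>x. x \<in> A \<longleftrightarrow> T x \<in> B))"

end

theory Submission
  imports Defs
begin

text \<open>
  From a circuit \<open>C\<close> with \<open>m\<close> inputs we build a register with \<open>m + 7\<close> stages. Normally it emits \<open>1\<close>
  exactly after \<open>m + 6\<close> zeros, a rule that does not look at the first bit of the state; if \<open>C\<close> is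
  unsatisfiable, this is all it does, and the same rule on \<open>m + 6\<close> stages is a subFSR. For a
  satisfying input \<open>a\<close>, the state \<open>c\<^sub>1 c\<^sub>2 a 1110 d\<close> emits \<open>e = c\<^sub>1 \<oplus> c\<^sub>2 d\<close> and its successor
  \<open>c\<^sub>2 a 1110 d e\<close> emits \<open>c\<^sub>2\<close>. A subFSR with \<open>m + 6\<close> stages starting from \<open>c\<^sub>1 c\<^sub>2 a 1110\<close> would
  choose \<open>d\<close> as a function of \<open>c\<^sub>1, c\<^sub>2\<close>. The first rule forces \<open>d = c\<^sub>1 \<oplus> h(c\<^sub>2)\<close> for some \<open>h\<close>;
  then \<open>(d, e)\<close> equals \<open>(d, d \<oplus> h(0))\<close> for \<open>c\<^sub>2 = 0\<close> and \<open>(d, h(1))\<close> for \<open>c\<^sub>2 = 1\<close>, and these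
  coincide for \<open>d = h(0) \<oplus> h(1)\<close>, so that the second rule cannot be obeyed. Smaller subFSRs never
  exist, because \<open>m + 6\<close> zeros followed by a \<open>1\<close> occur in every sequence. The circuit of the
  register contains one copy of \<open>C\<close> and is well-formed exactly if \<open>C\<close> is, so the reduction need not
  test this.

  For the polynomial time bound, programs over a fixed number of stacks are run by a Turing machine
  that keeps the stacks one after the other on its tape; each stack operation shifts a part of the tape.
\<close>

section \<open>Machines over an arbitrary finite state space\<close>

text \<open>The seven extra stages hold c1, c2, the marker 1110 and d. A register with m + 6 stages
  has lost c1 when it computes e, and has lost c2 as well when it computes the bit after e. Hence c2
  and d must determine c1, and then (d, e) must determine c2. Under the plain rule e = c1 this is
  possible: d = c1 xor c2 works. The product term c2 d is there to defeat every choice of d. The run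
  of zeros reduces the question to m + 6 stages: a shorter register would meet an all-zero state
  inside the run, emit 0 and stay at 0 forever, although the long register must emit a 1 after it.
  The marker has three ones because emitted bits never contain 111. So the special rules act only
  while bits of the initial state are still visible, and every state leads to the run of
  zeros.\<close>

definition gstep :: "('q \<Rightarrow> sym \<Rightarrow> 'q \<times> sym \<times> dir) \<Rightarrow> 'q \<Rightarrow> 'q \<times> sym list \<times> sym list \<Rightarrow> 'q \<times> sym list \<times> sym list" where
  "gstep \<delta> h c = (case c of (q, L, R) \<Rightarrow>
     if q = h then c else
     (let a = (case R of [] \<Rightarrow> Bl | x # _ \<Rightarrow> x);
          (q', b, d) = \<delta> q a;
          R' = b # tl R
      in case d of
          Lft \<Rightarrow> (case L of [] \<Rightarrow> (q', [], Bl # R') | y # L' \<Rightarrow> (q', L', y # R'))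
        | Rgt \<Rightarrow> (q', b # L, tl R)
        | Stay \<Rightarrow> (q', L, R')))"

text \<open>\<open>tm_run\<close> starts with nothing around the input, whereas the simulation below
  wants a blank on the left and K blanks on the right. A head that leaves the list finds a blank
  anyway, so additional blanks at the outer ends are invisible.\<close>

definition pad :: "'q \<times> sym list \<times> sym list \<Rightarrow> 'q \<times> sym list \<times> sym list \<Rightarrow> bool" where
  "pad c c' \<longleftrightarrow> fst c = fst c' \<and> (\<exists>i. fst (snd c') = fst (snd c) @ replicate i Bl)
     \<and> (\<exists>j. snd (snd c') = snd (snd c) @ replicate j Bl)"

lemma pad_gstep:
  assumes "pad c c'"
  shows "pad (gstep \<delta> h c) (gstep \<delta> h c')"
proof -
  obtain q L R where c: "c = (q, L, R)" by (cases c) auto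
  obtain i j where c': "c' = (q, L @ replicate i Bl, R @ replicate j Bl)"
    using assms c by (cases c') (auto simp: pad_def)
  show ?thesis
  proof (cases "q = h")
    case True
    then show ?thesis using assms by (simp add: gstep_def c c')
  next
    case False
    have hd_eq: "(case R @ replicate j Bl of [] \<Rightarrow> Bl | x # _ \<Rightarrow> x) = (case R of [] \<Rightarrow> Bl | x # _ \<Rightarrow> x)"
      by (cases R; cases j) auto
    have tl_eq: "\<exists>j'. tl (R @ replicate j Bl) = tl R @ replicate j' Bl"
    proof (cases R)
      case Nil
      then show ?thesis by (auto intro: exI[of _ "j - 1"])
    qed auto
    then obtain j' where j': "tl (R @ replicate j Bl) = tl R @ replicate j' Bl" by blast
    let ?a = "case R of [] \<Rightarrow> Bl | x # _ \<Rightarrow> x"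
    obtain q' b d where \<delta>: "\<delta> q ?a = (q', b, d)" by (cases "\<delta> q ?a") auto
    note step = gstep_def c c' hd_eq pad_def Let_def \<delta> j' False
    show ?thesis
    proof (cases d)
      case Lft
      show ?thesis
      proof (cases L)
        case Nil
        \<comment> \<open>At the left end the unpadded tape creates a blank where the padded one
          uses up one of its own.\<close>
        show ?thesis
        proof (cases i)
          case 0
          then show ?thesis using Lft Nil by (auto simp: step)
        next
          case (Suc i')
          then show ?thesis using Lft Nil by (auto simp: step)
        qed
      qed (use Lft in \<open>auto simp: step\<close>)
    qed (auto simp: step)
  qed
qed

lemma pad_gstep_funpow: "pad c c' \<Longrightarrow> pad ((gstep \<delta> h ^^ k) c) ((gstep \<delta> h ^^ k) c')"
  by (induction k) (auto intro: pad_gstep)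

lemma tm_step_gstep: "tm_step M = gstep (snd M) (fst M)"
  by (rule ext) (simp add: tm_step_def gstep_def)

lemma gstep_rename:
  assumes inj: "inj_on f Q" and h: "h \<in> Q" and q: "q \<in> Q"
    and closed: "\<And>q a. q \<in> Q \<Longrightarrow> fst (\<delta> q a) \<in> Q"
    and \<delta>': "\<And>q a. q \<in> Q \<Longrightarrow> q \<noteq> h \<Longrightarrow> \<delta>' (f q) a = (f (fst (\<delta> q a)), snd (\<delta> q a))"
  shows "gstep \<delta>' (f h) (f q, L, R) = map_prod f id (gstep \<delta> h (q, L, R))"
    and "fst (gstep \<delta> h (q, L, R)) \<in> Q"
proof -
  have *: "f q = f h \<longleftrightarrow> q = h" using inj h q by (auto dest: inj_onD)
  show "gstep \<delta>' (f h) (f q, L, R) = map_prod f id (gstep \<delta> h (q, L, R))"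
    using \<delta>'[OF q]
    by (auto simp: gstep_def * Let_def split: list.split dir.split prod.split)
  show "fst (gstep \<delta> h (q, L, R)) \<in> Q"
    using closed[OF q] q
    by (auto simp: gstep_def Let_def split: list.split dir.split prod.split) (metis fst_conv)+
qed

lemma poly_time_computableI:
  fixes \<delta> :: "'q \<Rightarrow> sym \<Rightarrow> 'q \<times> sym \<times> dir"
  assumes fin: "finite Q" and s: "s \<in> Q" and h: "h \<in> Q" and sh: "s \<noteq> h"
    and closed: "\<And>q a. q \<in> Q \<Longrightarrow> fst (\<delta> q a) \<in> Q"
    and run: "\<And>x. \<exists>k \<le> c * length x ^ d + c. \<exists>i j L R.
       (gstep \<delta> h ^^ k) (s, replicate i Bl, map bit_sym x @ replicate j Bl)
       = (h, L, map bit_sym (T x) @ Bl # R)"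
  shows "poly_time_computable T"
proof -
  define n where "n = card (Q - {s, h})"
  have "\<exists>g. bij_betw g (Q - {s, h}) {0..<n}"
    using fin by (simp add: n_def ex_bij_betw_finite_nat)
  then obtain g where g: "bij_betw g (Q - {s, h}) {0..<n}" by blast
  \<comment> \<open>Machines start in state 0 and halt in the state numbered by their first
    component, so \<open>s\<close> and \<open>h\<close> receive the two extreme numbers.\<close>
  define f where "f q = (if q = s then 0 else if q = h then Suc n else Suc (g q))" for q
  have g_less: "g q < n" if "q \<in> Q" "q \<noteq> s" "q \<noteq> h" for q
    using bij_betwE[OF g] that by auto
  have inj: "inj_on f Q"
  proof (rule inj_onI)
    fix p q assume "p \<in> Q" "q \<in> Q" "f p = f q"
    then show "p = q"
      using sh bij_betw_imp_inj_on[OF g, THEN inj_onD, of p q] g_less[of p] g_less[of q]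
      unfolding f_def by (simp split: if_splits)
  qed
  have f_le: "f q \<le> Suc n" if "q \<in> Q" for q
    using g_less[OF that] by (auto simp: f_def less_imp_le)
  have f_surj: "\<exists>q\<in>Q. f q = i \<and> q \<noteq> h" if "i < Suc n" for i
  proof (cases i)
    case 0
    then show ?thesis using s sh by (auto simp: f_def)
  next
    case (Suc j)
    then have "j \<in> {0..<n}" using that by simp
    then obtain q where "q \<in> Q - {s, h}" "g q = j"
      using g by (metis bij_betw_imp_surj_on imageE)
    then show ?thesis using Suc by (auto simp: f_def)
  qed
  define \<delta>' where "\<delta>' i a = (let q = inv_into Q f i in (f (fst (\<delta> q a)), snd (\<delta> q a)))" for i a
  have \<delta>': "\<delta>' (f q) a = (f (fst (\<delta> q a)), snd (\<delta> q a))" if "q \<in> Q" for q a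
    using inj that by (simp add: \<delta>'_def inv_into_f_f)
  define M :: tm where "M = (Suc n, \<delta>')"
  have fh: "f h = Suc n" and fs: "f s = 0" using sh by (auto simp: f_def)
  have wf: "tm_wf M"
    unfolding tm_wf_def M_def
  proof (intro allI impI, unfold fst_conv snd_conv)
    fix i a assume "i < Suc n"
    then obtain q where "q \<in> Q" "f q = i" using f_surj by blast
    then show "fst (\<delta>' i a) \<le> Suc n" using \<delta>' closed f_le by fastforce
  qed
  have sim: "(tm_step M ^^ k) (f q, L, R) = map_prod f id ((gstep \<delta> h ^^ k) (q, L, R))
     \<and> fst ((gstep \<delta> h ^^ k) (q, L, R)) \<in> Q" if "q \<in> Q" for k q L R
  proof (induction k)
    case 0
    then show ?case using that by simp
  next
    case (Suc k)
    obtain q' L' R' where c: "(gstep \<delta> h ^^ k) (q, L, R) = (q', L', R')"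
      by (cases "(gstep \<delta> h ^^ k) (q, L, R)") auto
    have q': "q' \<in> Q" using Suc c by simp
    have "tm_step M (f q', L', R') = map_prod f id (gstep \<delta> h (q', L', R'))"
      using gstep_rename(1)[where \<delta> = \<delta> and \<delta>' = \<delta>' and f = f, OF inj h q' closed \<delta>'] by (simp add: tm_step_gstep M_def fh)
    moreover have "fst (gstep \<delta> h (q', L', R')) \<in> Q"
      by (rule gstep_rename(2)[where \<delta> = \<delta> and \<delta>' = \<delta>' and f = f, OF inj h q' closed \<delta>'])
    ultimately show ?case using Suc c by (simp add: id_def)
  qed
  show ?thesis
    unfolding poly_time_computable_def
  proof (rule exI[of _ M], rule exI[of _ c], rule exI[of _ d], intro conjI allI)
    show "tm_wf M" by (rule wf)
    fix x
    obtain k i j L R where k: "k \<le> c * length x ^ d + c"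
      and r: "(gstep \<delta> h ^^ k) (s, replicate i Bl, map bit_sym x @ replicate j Bl)
         = (h, L, map bit_sym (T x) @ Bl # R)" using run by blast
    have "(tm_step M ^^ k) (0, replicate i Bl, map bit_sym x @ replicate j Bl)
        = (Suc n, L, map bit_sym (T x) @ Bl # R)"
      using sim[OF s, of k "replicate i Bl" "map bit_sym x @ replicate j Bl"] r fs fh by simp
    moreover have "pad (tm_run M k x) ((tm_step M ^^ k) (0, replicate i Bl, map bit_sym x @ replicate j Bl))"
      unfolding tm_run_def tm_step_gstep by (rule pad_gstep_funpow) (auto simp: pad_def)
    ultimately obtain j' where 1: "fst (tm_run M k x) = Suc n"
      and 2: "map bit_sym (T x) @ Bl # R = snd (snd (tm_run M k x)) @ replicate j' Bl"
      by (auto simp: pad_def)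
    have tw: "takeWhile (\<lambda>a. a \<noteq> Bl) (r @ replicate j' Bl) = takeWhile (\<lambda>a. a \<noteq> Bl) r" for r
      by (induction r) auto
    have nb: "\<forall>a\<in>set (map bit_sym (T x)). a \<noteq> Bl" by (auto simp: bit_sym_def)
    have "tm_output (tm_run M k x)
       = map (\<lambda>a. a = B1) (takeWhile (\<lambda>a. a \<noteq> Bl) (map bit_sym (T x) @ Bl # R))"
      unfolding tm_output_def 2 tw ..
    also have "\<dots> = map (\<lambda>a. a = B1) (map bit_sym (T x))"
      using nb by (subst takeWhile_append2) auto
    also have "\<dots> = T x"
      by (simp add: bit_sym_def map_idI o_def)
    finally show "\<exists>k\<le>c * length x ^ d + c. fst (tm_run M k x) = fst M \<and> tm_output (tm_run M k x) = T x"
      using k 1 by (auto simp: M_def)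
  qed
qed

section \<open>A stack language and its single-tape implementation\<close>

datatype com = SKIP | PUSH nat bool | POP nat | SEQ com com
  | IF nat "sym set" com com | WHILE nat "sym set" com

type_synonym stacks = "nat \<Rightarrow> bool list"

fun top :: "bool list \<Rightarrow> sym" where
  "top [] = Bl"
| "top (b # bs) = bit_sym b"

text \<open>The third argument is an upper bound on the number of steps, not the exact number.\<close>
inductive exec :: "com \<Rightarrow> stacks \<Rightarrow> nat \<Rightarrow> stacks \<Rightarrow> bool" where
  Skip: "1 \<le> n \<Longrightarrow> exec SKIP s n s"
| Push: "1 \<le> n \<Longrightarrow> exec (PUSH i b) s n (s(i := b # s i))"
| Pop: "1 \<le> n \<Longrightarrow> exec (POP i) s n (s(i := tl (s i)))"
| Seq: "exec c s m s' \<Longrightarrow> exec d s' n s'' \<Longrightarrow> m + n < k \<Longrightarrow> exec (SEQ c d) s k s''"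
| IfT: "top (s i) \<in> A \<Longrightarrow> exec c s n s' \<Longrightarrow> n < k \<Longrightarrow> exec (IF i A c d) s k s'"
| IfF: "top (s i) \<notin> A \<Longrightarrow> exec d s n s' \<Longrightarrow> n < k \<Longrightarrow> exec (IF i A c d) s k s'"
| WhileF: "top (s i) \<notin> A \<Longrightarrow> 1 \<le> n \<Longrightarrow> exec (WHILE i A c) s n s"
| WhileT: "top (s i) \<in> A \<Longrightarrow> exec c s m s' \<Longrightarrow> exec (WHILE i A c) s' n s'' \<Longrightarrow> m + n < k
    \<Longrightarrow> exec (WHILE i A c) s k s''"

fun com_wf :: "nat \<Rightarrow> com \<Rightarrow> bool" where
  "com_wf K SKIP = True"
| "com_wf K (PUSH i b) = (i < K)"
| "com_wf K (POP i) = (i < K)"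
| "com_wf K (SEQ c d) = (com_wf K c \<and> com_wf K d)"
| "com_wf K (IF i A c d) = (i < K \<and> com_wf K c \<and> com_wf K d)"
| "com_wf K (WHILE i A c) = (i < K \<and> com_wf K c)"

text \<open>Stack \<open>i\<close> occupies the \<open>i\<close>-th blank-terminated block of the tape; between commands the head
stands on the first cell, with one blank to its left.\<close>

abbreviation block :: "bool list \<Rightarrow> sym list" where
  "block bs \<equiv> map bit_sym bs @ [Bl]"

definition tape :: "nat \<Rightarrow> stacks \<Rightarrow> sym list" where
  "tape K s = concat (map (\<lambda>i. block (s i)) [0..<K])"

text \<open>A state of the machine is the list of commands still to be executed together with the phase
of the first one. \<open>Fwd k\<close> and \<open>Seek k\<close> move right past \<open>k\<close> blanks; \<open>Ins c k\<close> and \<open>Del c k\<close> shift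
the tape by one cell, carrying \<open>c\<close>; \<open>Home k\<close> returns to the first cell, which is \<open>k\<close> blanks away.\<close>

datatype phase = Start | Fwd nat | Seek nat | Ins sym nat | Del sym nat | Home nat

type_synonym state = "com list \<times> phase"

definition count_down :: "sym \<Rightarrow> nat \<Rightarrow> nat" where
  "count_down a k = (if a = Bl then k - 1 else k)"

text \<open>Entered with the head on the first cell of block i, so that a blank there means an empty
  stack. \<open>K - i\<close> counts the blanks up to the end of the last block, \<open>i\<close>
  those to be passed on the way back.\<close>

fun at_top :: "nat \<Rightarrow> com \<Rightarrow> com list \<Rightarrow> sym \<Rightarrow> state \<times> sym \<times> dir" where
  "at_top K (PUSH i b) cs a = ((PUSH i b # cs, Ins (bit_sym b) (K - i)), a, Stay)"
| "at_top K (POP i) cs a =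
     (if a = Bl then ((cs, Home i), a, Lft) else ((POP i # cs, Seek (K - i)), a, Stay))"
| "at_top K (IF i A c d) cs a = (((if a \<in> A then c else d) # cs, Home i), a, Lft)"
| "at_top K (WHILE i A c) cs a = ((if a \<in> A then c # WHILE i A c # cs else cs, Home i), a, Lft)"
| "at_top K c cs a = ((cs, Start), a, Stay)"

fun begin_com :: "com \<Rightarrow> com list \<Rightarrow> state" where
  "begin_com SKIP cs = (cs, Start)"
| "begin_com (SEQ c d) cs = (c # d # cs, Start)"
| "begin_com (PUSH i b) cs = (PUSH i b # cs, Fwd i)"
| "begin_com (POP i) cs = (POP i # cs, Fwd i)"
| "begin_com (IF i A c d) cs = (IF i A c d # cs, Fwd i)"
| "begin_com (WHILE i A c) cs = (WHILE i A c # cs, Fwd i)"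

fun com_index :: "com \<Rightarrow> nat" where
  "com_index (PUSH i b) = i"
| "com_index (POP i) = i"
| "com_index (IF i A c d) = i"
| "com_index (WHILE i A c) = i"
| "com_index _ = 0"

text \<open>The \<open>Home\<close> clause stands first because the command list may be empty while
  the head is still returning; only \<open>([], Start)\<close> halts. A deletion runs leftwards,
  passes the K - i blanks of the blocks from i on, and stops at the next blank, just before block
  i.\<close>

fun delta :: "nat \<Rightarrow> state \<Rightarrow> sym \<Rightarrow> state \<times> sym \<times> dir" where
  "delta K (cs, Home k) a =
     (if a \<noteq> Bl then ((cs, Home k), a, Lft)
      else if k = 0 then ((cs, Start), a, Rgt) else ((cs, Home (k - 1)), a, Lft))"
| "delta K ([], p) a = (([], Start), a, Stay)"
| "delta K (c # cs, Start) a = (begin_com c cs, a, Stay)"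
| "delta K (c # cs, Fwd k) a =
     (if k = 0 then at_top K c cs a else ((c # cs, Fwd (count_down a k)), a, Rgt))"
| "delta K (c # cs, Ins b k) a =
     (if k = 0 then ((cs, Home (K - 1)), b, Lft) else ((c # cs, Ins a (count_down a k)), b, Rgt))"
| "delta K (c # cs, Seek k) a =
     (if k = 0 then ((c # cs, Del Bl (K - com_index c)), a, Lft)
      else ((c # cs, Seek (count_down a k)), a, Rgt))"
| "delta K (c # cs, Del b k) a =
     (if k = 0 \<and> a = Bl then ((cs, Home (com_index c)), a, Stay)
      else ((c # cs, Del a (count_down a k)), b, Lft))"

abbreviation halt :: state where
  "halt \<equiv> ([], Start)"

section \<open>Sweeps of the head over the tape\<close>

definition reaches :: "nat \<Rightarrow> nat \<Rightarrow> state \<times> sym list \<times> sym list \<Rightarrow> state \<times> sym list \<times> sym list \<Rightarrow> bool" where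
  "reaches K n c c' \<longleftrightarrow> (\<exists>k\<le>n. (gstep (delta K) halt ^^ k) c = c')"

lemma reaches_refl: "reaches K n c c"
  unfolding reaches_def by (rule exI[of _ 0]) simp

lemma reaches_trans:
  assumes "reaches K m c c'" "reaches K n c' c''" "m + n \<le> l"
  shows "reaches K l c c''"
proof -
  obtain i j where i: "i \<le> m" "(gstep (delta K) halt ^^ i) c = c'"
    and j: "j \<le> n" "(gstep (delta K) halt ^^ j) c' = c''"
    using assms by (auto simp: reaches_def)
  have "(gstep (delta K) halt ^^ (j + i)) c = c''" using i j by (simp add: funpow_add)
  then show ?thesis unfolding reaches_def using i j assms(3) by (intro exI[of _ "j + i"]) auto
qed

lemma reaches_step:
  assumes "reaches K n (gstep (delta K) halt c) c'" "n < l"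
  shows "reaches K l c c'"
proof (rule reaches_trans[OF _ assms(1)])
  show "reaches K 1 c (gstep (delta K) halt c)"
    unfolding reaches_def by (rule exI[of _ 1]) simp
qed (use assms(2) in simp)

text \<open>Serves \<open>Fwd\<close> and \<open>Seek\<close> alike, hence the abstract
  \<open>st\<close>. As W ends with its k-th blank, the counter cannot reach 0 before W is
  exhausted.\<close>

lemma scan_right:
  assumes "\<And>k a. k \<noteq> 0 \<Longrightarrow> delta K (cs, st k) a = ((cs, st (count_down a k)), a, Rgt)"
    and "cs \<noteq> []"
    and "count_list W Bl = k" "W \<noteq> [] \<longrightarrow> last W = Bl"
  shows "reaches K (length W) ((cs, st k), L, W @ R) ((cs, st 0), rev W @ L, R)"
  using assms(3,4)
proof (induction W arbitrary: k L)
  case Nil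
  then show ?case by (simp add: reaches_refl)
next
  case (Cons a W)
  have k: "k \<noteq> 0"
    using Cons.prems last_in_set[of "a # W"] by (metis count_list_0_iff list.discI)
  have W: "count_list W Bl = count_down a k" "W \<noteq> [] \<longrightarrow> last W = Bl"
    using Cons.prems by (auto simp: count_down_def)
  have "gstep (delta K) halt ((cs, st k), L, (a # W) @ R) = ((cs, st (count_down a k)), a # L, W @ R)"
    using assms(1)[OF k] assms(2) by (simp add: gstep_def)
  then show ?case using Cons.IH[OF W, of "a # L"]
    by - (rule reaches_step[where n = "length W"], auto)
qed

text \<open>\<open>h # L\<close> is the tape read leftwards from the head. The k blanks inside U are
  passed, and the blank after U is the goal.\<close>

lemma home:
  assumes "count_list U Bl = k" "h # L = U @ Bl # V"
  shows "reaches K (Suc (length U)) ((cs, Home k), L, h # R) ((cs, Start), Bl # V, rev U @ R)"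
  using assms
proof (induction U arbitrary: k h L R)
  case Nil
  then show ?case by - (rule reaches_step[where n = 0], auto simp: gstep_def reaches_refl)
next
  case (Cons u U)
  have hu: "h = u" using Cons.prems(2) by simp
  obtain y L' where L: "L = y # L'" and L': "y # L' = U @ Bl # V"
    using Cons.prems by (cases L) auto
  have "gstep (delta K) halt ((cs, Home k), L, h # R) = ((cs, Home (count_down u k)), L', y # h # R)"
    using Cons.prems(1) unfolding L hu by (auto simp: gstep_def count_down_def)
  moreover have "count_list U Bl = count_down u k" using Cons.prems by (auto simp: count_down_def)
  ultimately show ?case using Cons.IH[OF _ L', of "count_down u k" "u # R"] Cons.prems
    by - (rule reaches_step[where n = "Suc (length U)"], auto)
qed

lemma insert_sweep:
  assumes "count_list W Bl = k" "W \<noteq> [] \<longrightarrow> last W = Bl"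
  shows "reaches K (length W) ((c # cs, Ins b k), L, W @ R)
     ((c # cs, Ins (last (b # W)) 0), rev (butlast (b # W)) @ L, R)"
  using assms
proof (induction W arbitrary: k b L)
  case Nil
  then show ?case by (simp add: reaches_refl)
next
  case (Cons a W)
  have k: "k \<noteq> 0"
    using Cons.prems last_in_set[of "a # W"] by (metis count_list_0_iff list.discI)
  have W: "count_list W Bl = count_down a k" "W \<noteq> [] \<longrightarrow> last W = Bl"
    using Cons.prems by (auto simp: count_down_def)
  have "gstep (delta K) halt ((c # cs, Ins b k), L, (a # W) @ R)
      = ((c # cs, Ins a (count_down a k)), b # L, W @ R)"
    using k by (simp add: gstep_def)
  then show ?case using Cons.IH[OF W, of a "b # L"]
    by - (rule reaches_step[where n = "length W"], auto)
qed

text \<open>In its use U is the reversed tape from block i on, so its last entry is the top of the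
  stack; this is the symbol that \<open>butlast\<close> drops.\<close>

lemma delete_sweep:
  assumes "count_list U Bl = k" "h # L = U @ Bl # V"
  shows "reaches K (Suc (length U)) ((c # cs, Del b k), L, h # R)
     ((cs, Home (com_index c)), V, Bl # rev (butlast (b # U)) @ R)"
  using assms
proof (induction U arbitrary: k h b L R)
  case Nil
  then show ?case by - (rule reaches_step[where n = 0], auto simp: gstep_def reaches_refl)
next
  case (Cons u U)
  have hu: "h = u" using Cons.prems(2) by simp
  obtain y L' where L: "L = y # L'" and L': "y # L' = U @ Bl # V"
    using Cons.prems by (cases L) auto
  have "gstep (delta K) halt ((c # cs, Del b k), L, h # R) = ((c # cs, Del u (count_down u k)), L', y # b # R)"
    using Cons.prems(1) unfolding L hu by (auto simp: gstep_def)
  moreover have "count_list U Bl = count_down u k" using Cons.prems by (auto simp: count_down_def)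
  ultimately show ?case using Cons.IH[OF _ L', of "count_down u k" u "b # R"] Cons.prems
    by - (rule reaches_step[where n = "Suc (length U)"], auto)
qed

lemma count_list_bits: "count_list (map bit_sym bs) Bl = 0"
  by (induction bs) (auto simp: bit_sym_def)

lemma count_list_blocks: "count_list (concat (map (\<lambda>i. block (s i)) is)) Bl = length is"
  by (induction "is") (auto simp: count_list_bits)

lemma last_blocks: "is \<noteq> [] \<Longrightarrow> last (concat (map (\<lambda>i. block (s i)) is)) = Bl"
  by (induction "is" rule: rev_induct) auto

abbreviation lower :: "stacks \<Rightarrow> nat \<Rightarrow> sym list" where
  "lower s i \<equiv> concat (map (\<lambda>i. block (s i)) [0..<i])"

abbreviation upper :: "nat \<Rightarrow> stacks \<Rightarrow> nat \<Rightarrow> sym list" where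
  "upper K s i \<equiv> concat (map (\<lambda>i. block (s i)) [Suc i..<K])"

lemma tape_split:
  assumes "i < K"
  shows "tape K s = lower s i @ block (s i) @ upper K s i"
proof -
  have "[0..<K] = [0..<i] @ i # [Suc i..<K]"
    using assms by (metis upt_add_eq_append upt_conv_Cons less_imp_add_positive le0 add_0)
  then show ?thesis by (simp add: tape_def)
qed

lemma tape_upd:
  assumes "i < K"
  shows "tape K (s(i := v)) = lower s i @ block v @ upper K s i"
proof -
  have "lower (s(i := v)) i = lower s i" "upper K (s(i := v)) i = upper K s i"
    by (auto intro!: arg_cong[where f = concat])
  then show ?thesis using tape_split[OF assms, of "s(i := v)"] by simp
qed

section \<open>Execution of a single command\<close>

definition config :: "nat \<Rightarrow> stacks \<Rightarrow> nat \<Rightarrow> com list \<Rightarrow> state \<times> sym list \<times> sym list" where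
  "config K s j cs = ((cs, Start), [Bl], tape K s @ replicate j Bl)"

lemma length_tape: "i < K \<Longrightarrow> length (tape K s) = length (lower s i) + Suc (length (s i)) + length (upper K s i)"
  by (simp add: tape_split)

lemma count_upper: "i < K \<Longrightarrow> count_list (block v @ upper K s i) Bl = K - i"
  by (simp add: count_list_blocks count_list_bits)

lemma last_upper: "last (block v @ upper K s i) = Bl"
  using last_blocks[of "[Suc i..<K]" s] by (auto simp: last_append)

lemma reaches_top:
  assumes i: "i < K" and c: "begin_com c cs = (c # cs, Fwd i)"
  shows "reaches K (Suc (length (lower s i))) (config K s j (c # cs))
    ((c # cs, Fwd 0), rev (lower s i) @ [Bl], block (s i) @ upper K s i @ replicate j Bl)"
proof -
  have "gstep (delta K) halt (config K s j (c # cs))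
      = ((c # cs, Fwd i), [Bl], lower s i @ block (s i) @ upper K s i @ replicate j Bl)"
    by (cases "tape K s @ replicate j Bl") (simp_all add: gstep_def config_def tape_split[OF i] c)
  moreover have "reaches K (length (lower s i))
      ((c # cs, Fwd i), [Bl], lower s i @ block (s i) @ upper K s i @ replicate j Bl)
      ((c # cs, Fwd 0), rev (lower s i) @ [Bl], block (s i) @ upper K s i @ replicate j Bl)"
    by (rule scan_right) (auto simp: count_list_blocks last_blocks)
  ultimately show ?thesis by (metis reaches_step lessI)
qed

text \<open>Covers the tests and the \<open>POP\<close> of an empty stack: both inspect the top cell
  and walk back unchanged. The factor 12 is a generous bound common to all commands.\<close>

lemma reaches_branch:
  assumes i: "i < K" and c: "begin_com c cs = (c # cs, Fwd i)"
    and b: "at_top K c cs (top (s i)) = ((cs', Home i), top (s i), Lft)"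
  shows "reaches K (12 * length (tape K s)) (config K s j (c # cs)) (config K s j cs')"
proof -
  let ?R = "block (s i) @ upper K s i @ replicate j Bl"
  obtain h L where hL: "rev (lower s i) @ [Bl] = h # L" by (cases "rev (lower s i)") auto
  obtain r R where R: "?R = r # R" and r: "r = top (s i)" by (cases "s i") auto
  have 1: "gstep (delta K) halt ((c # cs, Fwd 0), rev (lower s i) @ [Bl], ?R)
      = ((cs', Home i), L, h # ?R)"
    unfolding hL R using b r by (simp add: gstep_def)
  have 2: "reaches K (Suc (length (lower s i))) ((cs', Home i), L, h # ?R)
      ((cs', Start), [Bl], rev (rev (lower s i)) @ ?R)"
    using home[of "rev (lower s i)" i h L "[]"] by (simp add: hL count_list_blocks)
  have 3: "reaches K (Suc (Suc (length (lower s i)))) ((c # cs, Fwd 0), rev (lower s i) @ [Bl], ?R)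
     (config K s j cs')"
    by (rule reaches_step[where n = "Suc (length (lower s i))"])
       (use 1 2 in \<open>auto simp: config_def tape_split[OF i]\<close>)
  show ?thesis
    by (rule reaches_trans[OF reaches_top[OF i c] 3]) (simp add: length_tape[OF i])
qed

lemma reaches_push:
  assumes i: "i < K"
  shows "\<exists>j'. reaches K (12 * length (tape K s)) (config K s j (PUSH i b # cs))
    (config K (s(i := b # s i)) j' cs)"
proof -
  let ?W = "block (s i) @ upper K s i" and ?b = "bit_sym b"
  let ?B = "butlast (?b # ?W)"
  let ?c = "PUSH i b"
  have "rev ?B @ rev (lower s i) @ [Bl] \<noteq> []" by simp
  then obtain h L where hL: "rev ?B @ rev (lower s i) @ [Bl] = h # L"
    by (auto simp only: neq_Nil_conv)
  have W: "last (?b # ?W) = Bl" using last_upper[of "s i" s i K] by (auto simp: last_append)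
  have BW: "?B @ [Bl] = ?b # ?W"
    using append_butlast_last_id[of "?b # ?W"] by (simp only: W) simp
  have cB: "Suc (count_list ?B Bl) = K - i"
  proof -
    have "Suc (count_list ?B Bl) = count_list (?B @ [Bl]) Bl" by (simp del: butlast.simps)
    also have "\<dots> = count_list ?W Bl" unfolding BW by (simp add: bit_sym_def)
    finally show ?thesis using count_upper[OF i, of "s i" s] by (simp only:)
  qed
  have 1: "gstep (delta K) halt ((?c # cs, Fwd 0), rev (lower s i) @ [Bl], ?W @ replicate j Bl)
      = ((?c # cs, Ins ?b (K - i)), rev (lower s i) @ [Bl], ?W @ replicate j Bl)"
    by (cases "?W @ replicate j Bl") (simp_all add: gstep_def)
  have 2: "reaches K (length ?W) ((?c # cs, Ins ?b (K - i)), rev (lower s i) @ [Bl], ?W @ replicate j Bl)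
      ((?c # cs, Ins Bl 0), rev ?B @ rev (lower s i) @ [Bl], replicate j Bl)"
    using insert_sweep[of ?W "K - i" K ?c cs ?b "rev (lower s i) @ [Bl]" "replicate j Bl"]
      count_upper[OF i, of "s i" s] last_upper[of "s i" s i K] W by simp
  \<comment> \<open>For j = 0 the tape grows by one cell here; otherwise the final terminator takes
    one of the j spare blanks.\<close>
  have 3: "gstep (delta K) halt ((?c # cs, Ins Bl 0), h # L, replicate j Bl)
      = ((cs, Home (K - 1)), L, h # Bl # replicate (j - 1) Bl)"
    by (cases j) (simp_all add: gstep_def)
  have 4: "reaches K (Suc (length (rev ?B @ rev (lower s i))))
      ((cs, Home (K - 1)), L, h # Bl # replicate (j - 1) Bl)
      ((cs, Start), [Bl], rev (rev ?B @ rev (lower s i)) @ Bl # replicate (j - 1) Bl)"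
    by (rule home) (use cB i hL in \<open>auto simp: count_list_blocks\<close>)
  have 5: "rev (rev ?B @ rev (lower s i)) @ Bl # replicate (j - 1) Bl
      = tape K (s(i := b # s i)) @ replicate (j - 1) Bl"
  proof -
    have "?B @ Bl # replicate (j - 1) Bl = (?B @ [Bl]) @ replicate (j - 1) Bl"
      by (simp del: butlast.simps)
    also have "\<dots> = (?b # ?W) @ replicate (j - 1) Bl" by (simp only: BW)
    finally show ?thesis by (simp add: tape_upd[OF i] del: butlast.simps)
  qed
  have 6: "reaches K (Suc (Suc (length (rev ?B @ rev (lower s i)))))
      ((?c # cs, Ins Bl 0), h # L, replicate j Bl) (config K (s(i := b # s i)) (j - 1) cs)"
    by (rule reaches_step[where n = "Suc (length (rev ?B @ rev (lower s i)))"])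
       (unfold 3 config_def 5[symmetric], rule 4, simp)
  have 7: "reaches K (length ?W + Suc (Suc (length (rev ?B @ rev (lower s i)))))
      ((?c # cs, Ins ?b (K - i)), rev (lower s i) @ [Bl], ?W @ replicate j Bl)
      (config K (s(i := b # s i)) (j - 1) cs)"
    by (rule reaches_trans[OF 2[unfolded hL] 6]) simp
  have 8: "reaches K (Suc (length ?W + Suc (Suc (length (rev ?B @ rev (lower s i))))))
      ((?c # cs, Fwd 0), rev (lower s i) @ [Bl], ?W @ replicate j Bl)
      (config K (s(i := b # s i)) (j - 1) cs)"
    by (rule reaches_step[OF _ lessI]) (unfold 1, rule 7)
  have top: "reaches K (Suc (length (lower s i))) (config K s j (?c # cs))
      ((?c # cs, Fwd 0), rev (lower s i) @ [Bl], ?W @ replicate j Bl)"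
    using reaches_top[OF i, of ?c cs s j] by simp
  have "reaches K (12 * length (tape K s)) (config K s j (?c # cs))
      (config K (s(i := b # s i)) (j - 1) cs)"
    by (rule reaches_trans[OF top 8]) (simp add: length_tape[OF i])
  then show ?thesis by blast
qed

lemma reaches_pop:
  assumes i: "i < K"
  shows "\<exists>j'. reaches K (12 * length (tape K s)) (config K s j (POP i # cs))
    (config K (s(i := tl (s i))) j' cs)"
proof (cases "s i")
  case Nil
  then have "s(i := tl (s i)) = s" by auto
  then show ?thesis using reaches_branch[OF i, of "POP i" cs s cs j] Nil by auto
next
  case (Cons x xs)
  let ?W = "block (s i) @ upper K s i" and ?W' = "block xs @ upper K s i"
  let ?c = "POP i"
  have W: "?W = bit_sym x # ?W'" by (simp add: Cons)
  have "rev ?W @ rev (lower s i) @ [Bl] \<noteq> []" by simp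
  then obtain h L where hL: "rev ?W @ rev (lower s i) @ [Bl] = h # L"
    by (auto simp only: neq_Nil_conv)
  obtain V where V: "rev (lower s i) @ [Bl] = Bl # V"
  proof (cases i)
    case (Suc i')
    then show ?thesis using that by simp
  qed (use that in simp)
  \<comment> \<open>The head turns on the cell behind the last block, so this cell is present
    afterwards even if j = 0.\<close>
  define R where "R = Bl # replicate (j - 1) Bl"
  have 1: "gstep (delta K) halt ((?c # cs, Fwd 0), rev (lower s i) @ [Bl], ?W @ replicate j Bl)
      = ((?c # cs, Seek (K - i)), rev (lower s i) @ [Bl], ?W @ replicate j Bl)"
    by (simp add: gstep_def W bit_sym_def del: append_assoc)
  have 2: "reaches K (length ?W) ((?c # cs, Seek (K - i)), rev (lower s i) @ [Bl], ?W @ replicate j Bl)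
      ((?c # cs, Seek 0), rev ?W @ rev (lower s i) @ [Bl], replicate j Bl)"
    by (rule scan_right) (use count_upper[OF i, of "s i" s] last_upper[of "s i" s i K] in auto)
  have 3: "gstep (delta K) halt ((?c # cs, Seek 0), h # L, replicate j Bl)
      = ((?c # cs, Del Bl (K - i)), L, h # R)"
    by (cases j) (simp_all add: gstep_def R_def)
  have 4: "reaches K (Suc (length (rev ?W))) ((?c # cs, Del Bl (K - i)), L, h # R)
      ((cs, Home (com_index ?c)), V, Bl # rev (butlast (Bl # rev ?W)) @ R)"
    by (rule delete_sweep) (use count_upper[OF i, of "s i" s] hL V in auto)
  have 5: "rev (butlast (Bl # rev ?W)) = ?W' @ [Bl]"
    unfolding W by (simp add: butlast_append)
  have 6: "reaches K (Suc (length (rev (lower s i)))) ((cs, Home i), V, Bl # (?W' @ [Bl]) @ R)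
      ((cs, Start), Bl # [], rev (rev (lower s i)) @ (?W' @ [Bl]) @ R)"
    by (rule home) (use V in \<open>auto simp: count_list_blocks\<close>)
  have 7: "((cs, Start), Bl # [], rev (rev (lower s i)) @ (?W' @ [Bl]) @ R)
      = config K (s(i := tl (s i))) (Suc (Suc (j - 1))) cs"
    by (simp add: config_def tape_upd[OF i] Cons R_def)
  have 8: "reaches K (2 + length ?W + length (lower s i)) ((?c # cs, Del Bl (K - i)), L, h # R)
      (config K (s(i := tl (s i))) (Suc (Suc (j - 1))) cs)"
    by (rule reaches_trans[OF 4[unfolded 5 com_index.simps] 6[unfolded 7]]) simp
  have 9: "reaches K (3 + length ?W + length (lower s i)) ((?c # cs, Seek 0), h # L, replicate j Bl)
      (config K (s(i := tl (s i))) (Suc (Suc (j - 1))) cs)"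
    by (rule reaches_step[OF _ _]) (unfold 3, rule 8, simp)
  have 10: "reaches K (3 + 2 * length ?W + length (lower s i))
      ((?c # cs, Seek (K - i)), rev (lower s i) @ [Bl], ?W @ replicate j Bl)
      (config K (s(i := tl (s i))) (Suc (Suc (j - 1))) cs)"
    by (rule reaches_trans[OF 2[unfolded hL] 9]) simp
  have 11: "reaches K (4 + 2 * length ?W + length (lower s i))
      ((?c # cs, Fwd 0), rev (lower s i) @ [Bl], ?W @ replicate j Bl)
      (config K (s(i := tl (s i))) (Suc (Suc (j - 1))) cs)"
    by (rule reaches_step[OF _ _]) (unfold 1, rule 10, simp)
  have top: "reaches K (Suc (length (lower s i))) (config K s j (?c # cs))
      ((?c # cs, Fwd 0), rev (lower s i) @ [Bl], ?W @ replicate j Bl)"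
    using reaches_top[OF i, of ?c cs s j] by simp
  have "reaches K (12 * length (tape K s)) (config K s j (?c # cs))
      (config K (s(i := tl (s i))) (Suc (Suc (j - 1))) cs)"
    by (rule reaches_trans[OF top 11]) (simp add: length_tape[OF i])
  then show ?thesis by blast
qed


section \<open>Time and space of whole programs\<close>

lemma length_tape_upd:
  assumes "i < K"
  shows "length (tape K (s(i := v))) + length (s i) = length (tape K s) + length v"
  using length_tape[OF assms, of s] by (simp add: tape_upd[OF assms])

lemma length_tape_ge: "K \<le> length (tape K s)"
  unfolding tape_def by (induction K) auto

lemma exec_length_tape: "exec c s n s' \<Longrightarrow> com_wf K c \<Longrightarrow> length (tape K s') \<le> length (tape K s) + n"
proof (induction rule: exec.induct)
  case (Push n i b s)
  then show ?case using length_tape_upd[where i = i and K = K and s = s and v = "b # s i"] by (simp add: fun_upd_def)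
next
  case (Pop n i s)
  then show ?case using length_tape_upd[where i = i and K = K and s = s and v = "tl (s i)"] by (simp add: fun_upd_def)
qed auto

lemma gstep_internal:
  assumes "\<And>a. delta K (c # cs, Start) a = ((cs', Start), a, Stay)"
  shows "\<exists>j'. reaches K 1 (config K s j (c # cs)) (config K s j' cs')"
proof -
  have "gstep (delta K) halt (config K s j (c # cs))
      = ((cs', Start), [Bl], (case tape K s @ replicate j Bl of [] \<Rightarrow> Bl | x # _ \<Rightarrow> x) # tl (tape K s @ replicate j Bl))"
    using assms by (simp add: gstep_def config_def)
  also have "\<exists>j'. \<dots> = config K s j' cs'"
  proof (cases "tape K s @ replicate j Bl")
    case Nil
    then show ?thesis by (auto simp: config_def intro!: exI[of _ "Suc 0"])
  next
    case (Cons x xs)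
    then show ?thesis unfolding config_def by (intro exI[of _ j]) simp
  qed
  finally show ?thesis
    by (metis One_nat_def lessI reaches_refl reaches_step)
qed

text \<open>The inductive step of the quadratic bound. The strictness of m + n < k, built into the
  rules of \<open>exec\<close>, pays for the sweeps of cost 12 l, and l' is a tape that has grown
  during the first m steps.\<close>

lemma exec_cost_bound:
  fixes l l' m n k :: nat
  assumes "m + n < k" "l' \<le> l + m"
  shows "12 * l + (12 * m * (l + m) + 12 * n * (l' + n)) \<le> 12 * k * (l + k)"
proof -
  have "12 * l + (12 * m * (l + m) + 12 * n * (l' + n))
      \<le> 12 * (l + k) + (12 * m * (l + k) + 12 * n * (l + k))"
    by (intro add_mono[OF _ add_mono] mult_le_mono2) (use assms in linarith)+
  also have "\<dots> = 12 * Suc (m + n) * (l + k)" by (simp add: algebra_simps)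
  also have "\<dots> \<le> 12 * k * (l + k)" using assms by (intro mult_le_mono) auto
  finally show ?thesis .
qed

text \<open>Each of the n elementary steps costs a few sweeps over a tape with at most n cells more
  than initially.\<close>

lemma exec_reaches:
  assumes "exec c s n s'" "com_wf K c" "0 < K"
  shows "\<exists>j'. reaches K (12 * n * (length (tape K s) + n)) (config K s j (c # cs)) (config K s' j' cs)"
  using assms
proof (induction arbitrary: cs j rule: exec.induct)
  case (Skip n s)
  obtain j' where "reaches K 1 (config K s j (SKIP # cs)) (config K s j' cs)"
    using gstep_internal[of K SKIP cs cs s j] by auto
  then have "reaches K (12 * n * (length (tape K s) + n)) (config K s j (SKIP # cs)) (config K s j' cs)"
    by (rule reaches_trans[OF _ reaches_refl[of K 0]]) (use Skip in auto)
  then show ?case ..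
next
  case (Push n i b s)
  obtain j' where "reaches K (12 * length (tape K s)) (config K s j (PUSH i b # cs)) (config K (s(i := b # s i)) j' cs)"
    using reaches_push[of i K s j b cs] Push by auto
  then have "reaches K (12 * n * (length (tape K s) + n)) (config K s j (PUSH i b # cs)) (config K (s(i := b # s i)) j' cs)"
    by (rule reaches_trans[OF _ reaches_refl[of K 0]]) (use exec_cost_bound[of 0 0 n] Push in auto)
  then show ?case ..
next
  case (Pop n i s)
  obtain j' where "reaches K (12 * length (tape K s)) (config K s j (POP i # cs)) (config K (s(i := tl (s i))) j' cs)"
    using reaches_pop[of i K s j cs] Pop by auto
  then have "reaches K (12 * n * (length (tape K s) + n)) (config K s j (POP i # cs)) (config K (s(i := tl (s i))) j' cs)"
    by (rule reaches_trans[OF _ reaches_refl[of K 0]]) (use exec_cost_bound[of 0 0 n] Pop in auto)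
  then show ?case ..
next
  case (Seq c s m s' d n s'' k)
  obtain j1 where 1: "reaches K 1 (config K s j (SEQ c d # cs)) (config K s j1 (c # d # cs))"
    using gstep_internal[of K "SEQ c d" cs "c # d # cs" s j] by auto
  obtain j2 where 2: "reaches K (12 * m * (length (tape K s) + m)) (config K s j1 (c # d # cs)) (config K s' j2 (d # cs))"
    using Seq.IH(1)[of j1 "d # cs"] Seq.prems by auto
  obtain j3 where 3: "reaches K (12 * n * (length (tape K s') + n)) (config K s' j2 (d # cs)) (config K s'' j3 cs)"
    using Seq.IH(2)[of j2 cs] Seq.prems by auto
  have l: "length (tape K s') \<le> length (tape K s) + m" using exec_length_tape Seq by auto
  have "1 \<le> 12 * length (tape K s)" using length_tape_ge[of K s] Seq.prems by linarith
  then have "reaches K (12 * k * (length (tape K s) + k)) (config K s j (SEQ c d # cs)) (config K s'' j3 cs)"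
    using exec_cost_bound[OF Seq.hyps(3) l]
    by (intro reaches_trans[OF 1 reaches_trans[OF 2 3 order_refl]]) linarith
  then show ?case ..
next
  case (IfT s i A c n s' k d)
  have 1: "reaches K (12 * length (tape K s)) (config K s j (IF i A c d # cs)) (config K s j (c # cs))"
    using IfT by (intro reaches_branch) auto
  obtain j2 where 2: "reaches K (12 * n * (length (tape K s) + n)) (config K s j (c # cs)) (config K s' j2 cs)"
    using IfT.IH[of j cs] IfT.prems by auto
  have "reaches K (12 * k * (length (tape K s) + k)) (config K s j (IF i A c d # cs)) (config K s' j2 cs)"
    using exec_cost_bound[of n 0 k "length (tape K s)" "length (tape K s)"] IfT.hyps
    by (intro reaches_trans[OF 1 2]) simp
  then show ?case ..
next
  case (IfF s i A d n s' k c)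
  have 1: "reaches K (12 * length (tape K s)) (config K s j (IF i A c d # cs)) (config K s j (d # cs))"
    using IfF by (intro reaches_branch) auto
  obtain j2 where 2: "reaches K (12 * n * (length (tape K s) + n)) (config K s j (d # cs)) (config K s' j2 cs)"
    using IfF.IH[of j cs] IfF.prems by auto
  have "reaches K (12 * k * (length (tape K s) + k)) (config K s j (IF i A c d # cs)) (config K s' j2 cs)"
    using exec_cost_bound[of n 0 k "length (tape K s)" "length (tape K s)"] IfF.hyps
    by (intro reaches_trans[OF 1 2]) simp
  then show ?case ..
next
  case (WhileF s i A n c)
  have "reaches K (12 * length (tape K s)) (config K s j (WHILE i A c # cs)) (config K s j cs)"
    using WhileF by (intro reaches_branch) auto
  then have "reaches K (12 * n * (length (tape K s) + n)) (config K s j (WHILE i A c # cs)) (config K s j cs)"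
    by (rule reaches_trans[OF _ reaches_refl[of K 0]]) (use exec_cost_bound[of 0 0 n] WhileF in auto)
  then show ?case ..
next
  case (WhileT s i A c m s' n s'' k)
  have 1: "reaches K (12 * length (tape K s)) (config K s j (WHILE i A c # cs)) (config K s j (c # WHILE i A c # cs))"
    using WhileT by (intro reaches_branch) auto
  obtain j2 where 2: "reaches K (12 * m * (length (tape K s) + m)) (config K s j (c # WHILE i A c # cs)) (config K s' j2 (WHILE i A c # cs))"
    using WhileT.IH(1)[of j "WHILE i A c # cs"] WhileT.prems by auto
  obtain j3 where 3: "reaches K (12 * n * (length (tape K s') + n)) (config K s' j2 (WHILE i A c # cs)) (config K s'' j3 cs)"
    using WhileT.IH(2)[of j2 cs] WhileT.prems by auto
  have l: "length (tape K s') \<le> length (tape K s) + m" using exec_length_tape WhileT by auto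
  have "reaches K (12 * k * (length (tape K s) + k)) (config K s j (WHILE i A c # cs)) (config K s'' j3 cs)"
    using exec_cost_bound[OF WhileT.hyps(4) l]
    by (intro reaches_trans[OF 1 reaches_trans[OF 2 3 order_refl]]) linarith
  then show ?case ..
qed

section \<open>Finiteness of the control\<close>

fun conts :: "com \<Rightarrow> com list \<Rightarrow> com list set" where
  "conts (SEQ c d) cs = insert (SEQ c d # cs) (conts c (d # cs) \<union> conts d cs)"
| "conts (IF i A c d) cs = insert (IF i A c d # cs) (conts c cs \<union> conts d cs)"
| "conts (WHILE i A c) cs = insert (WHILE i A c # cs) (conts c (WHILE i A c # cs))"
| "conts c cs = {c # cs}"

text \<open>The tail \<open>cs\<close> is included for every command because \<open>Ins\<close> and
  \<open>Del\<close> drop the first command whatever it is.\<close>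

fun next_conts :: "com list \<Rightarrow> com list set" where
  "next_conts [] = {[]}"
| "next_conts (SEQ c d # cs) = {c # d # cs, cs}"
| "next_conts (IF i A c d # cs) = {c # cs, d # cs, cs}"
| "next_conts (WHILE i A c # cs) = {c # WHILE i A c # cs, cs}"
| "next_conts (c # cs) = {cs}"

lemma finite_conts: "finite (conts c cs)"
  by (induction c arbitrary: cs) auto

lemma conts_self: "c # cs \<in> conts c cs"
  by (cases c) auto

text \<open>This is why finitely many command lists suffice: after its body a \<open>WHILE\<close>
  returns to the very list from which it started, and that list is already in the set.\<close>

lemma conts_closed: "ds \<in> conts c cs \<Longrightarrow> next_conts ds \<subseteq> insert cs (conts c cs)"
proof (induction c arbitrary: cs)
  case (SEQ c d)
  then show ?case using SEQ.IH(1)[of "d # cs"] SEQ.IH(2)[of cs]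
      conts_self[of c "d # cs"] conts_self[of d cs] by auto
next
  case (IF i A c d)
  then show ?case using IF.IH(1)[of cs] IF.IH(2)[of cs]
      conts_self[of c cs] conts_self[of d cs] by auto
next
  case (WHILE i A c)
  then show ?case using WHILE.IH[of "WHILE i A c # cs"] conts_self[of c "WHILE i A c # cs"] by auto
qed auto

lemma conts_wf: "d # ds \<in> conts c cs \<Longrightarrow> com_wf K c \<Longrightarrow> com_wf K d"
  by (induction c arbitrary: cs) auto

lemma next_conts_tl: "cs \<in> next_conts (c # cs)"
  by (cases c) auto

lemma fst_begin_com: "fst (begin_com c cs) \<in> {c # cs} \<union> next_conts (c # cs)"
  by (cases c) auto

lemma fst_at_top: "fst (fst (at_top K c cs a)) \<in> {c # cs} \<union> next_conts (c # cs)"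
  by (cases c) auto

lemma fst_delta: "fst (fst (delta K (ds, p) a)) \<in> {ds} \<union> next_conts ds"
  using fst_begin_com fst_at_top[of K] next_conts_tl
  by (cases ds; cases p) (auto split: if_splits)

fun bounded :: "nat \<Rightarrow> phase \<Rightarrow> bool" where
  "bounded K Start = True"
| "bounded K (Fwd k) = (k \<le> K)"
| "bounded K (Seek k) = (k \<le> K)"
| "bounded K (Home k) = (k \<le> K)"
| "bounded K (Ins b k) = (k \<le> K)"
| "bounded K (Del b k) = (k \<le> K)"

lemma finite_bounded: "finite {p. bounded K p}"
proof (rule finite_subset)
  have "p \<in> insert Start (Fwd ` {..K} \<union> Seek ` {..K} \<union> Home ` {..K}
     \<union> (\<Union>b \<in> {Bl, B0, B1}. Ins b ` {..K} \<union> Del b ` {..K}))" if "bounded K p" for p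
  proof (cases p)
    case (Ins b k)
    then show ?thesis using that by (cases b) auto
  next
    case (Del b k)
    then show ?thesis using that by (cases b) auto
  qed (use that in auto)
  then show "{p. bounded K p} \<subseteq> insert Start (Fwd ` {..K} \<union> Seek ` {..K} \<union> Home ` {..K}
     \<union> (\<Union>b \<in> {Bl, B0, B1}. Ins b ` {..K} \<union> Del b ` {..K}))" by blast
qed simp

lemma snd_delta:
  assumes "bounded K p" "\<And>d ds'. ds = d # ds' \<Longrightarrow> com_wf K d"
  shows "bounded K (snd (fst (delta K (ds, p) a)))"
proof (cases ds)
  case Nil
  then show ?thesis using assms by (cases p) auto
next
  case (Cons d ds')
  then have wf: "com_wf K d" using assms by blast
  have "count_down a k \<le> K" if "k \<le> K" for k
    using that by (auto simp: count_down_def)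
  moreover have "bounded K (snd (begin_com d ds'))" using wf by (cases d) auto
  moreover have "bounded K (snd (fst (at_top K d ds' a)))" using wf by (cases d) auto
  moreover have "k - Suc 0 \<le> K" if "k \<le> K" for k using that by simp
  moreover have "com_index d \<le> K" using wf by (cases d) auto
  ultimately show ?thesis using assms(1) unfolding Cons by (cases p) (simp_all split: if_split)
qed

section \<open>From stack programs to polynomial time\<close>

definition input :: "bool list \<Rightarrow> stacks" where
  "input x = (\<lambda>_. [])(0 := x)"

lemma tape_input: "0 < K \<Longrightarrow> tape K (input x) = map bit_sym x @ replicate K Bl"
proof -
  assume K: "0 < K"
  have "concat (map (\<lambda>i. block (input x i)) [Suc 0..<n]) = replicate (n - 1) Bl" for n
  proof (induction n)
    case (Suc n)
    then show ?case by (cases n) (auto simp: input_def replicate_append_same)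
  qed simp
  moreover have "input x 0 = x" by (simp add: input_def)
  ultimately show ?thesis using tape_split[OF K, of "input x"] K by (cases K) (simp_all del: upt_Suc)
qed

text \<open>The simulation squares the time, so the exponent 2 becomes 4. The constant 192 is 12 *
  16: 12 comes from \<open>exec_reaches\<close>, and 16 from (l + 1)^4 <= (2 l)^4 for positive
  l.\<close>

lemma poly_time_computable_exec:
  assumes wf: "com_wf K c" and K: "0 < K"
    and run: "\<And>x. \<exists>s. exec c (input x) (A * Suc (length x) ^ 2) s \<and> s 0 = T x"
  shows "poly_time_computable T"
proof (rule poly_time_computableI[where \<delta> = "delta K" and s = "([c], Start)" and h = halt
      and Q = "insert [] (conts c []) \<times> {p. bounded K p}" and c = "192 * A * (K + A + 1)" and d = 4])
  show "finite (insert [] (conts c []) \<times> {p. bounded K p})"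
    by (simp add: finite_conts finite_bounded)
  show "([c], Start) \<in> insert [] (conts c []) \<times> {p. bounded K p}"
    using conts_self by auto
  fix q a assume q: "q \<in> insert [] (conts c []) \<times> {p. bounded K p}"
  obtain ds p where [simp]: "q = (ds, p)" by (cases q)
  have "next_conts ds \<subseteq> insert [] (conts c [])"
    using q conts_closed[of ds c "[]"] by auto
  moreover have "bounded K (snd (fst (delta K (ds, p) a)))"
    using q conts_wf[OF _ wf] by (intro snd_delta) auto
  ultimately show "fst (delta K q a) \<in> insert [] (conts c []) \<times> {p. bounded K p}"
    using fst_delta[of K ds p a] q by (auto simp: mem_Times_iff)
next
  fix x :: "bool list"
  define l where "l = length x"
  define n where "n = A * Suc l ^ 2"
  obtain s where s: "exec c (input x) n s" "s 0 = T x" using run by (auto simp: n_def l_def)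
  obtain j where "reaches K (12 * n * (length (tape K (input x)) + n)) (config K (input x) 0 [c]) (config K s j [])"
    using exec_reaches[OF s(1) wf K] by blast
  then obtain k where k: "k \<le> 12 * n * (l + K + n)"
    and r: "(gstep (delta K) halt ^^ k) (config K (input x) 0 [c]) = config K s j []"
    by (auto simp: reaches_def tape_input[OF K] l_def)
  have "l + K + n \<le> (K + A + 1) * Suc l ^ 2"
  proof -
    have "l \<le> Suc l ^ 2" by (simp add: power2_eq_square)
    moreover have "K \<le> K * Suc l ^ 2" by simp
    ultimately show ?thesis unfolding n_def distrib_right by linarith
  qed
  then have "12 * n * (l + K + n) \<le> 12 * n * ((K + A + 1) * Suc l ^ 2)" by (rule mult_le_mono2)
  also have "\<dots> = 12 * A * (K + A + 1) * Suc l ^ 4"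
    by (simp add: n_def power2_eq_square power4_eq_xxxx algebra_simps del: power_Suc)
  also have "\<dots> \<le> 12 * A * (K + A + 1) * (16 * l ^ 4 + 16)"
  proof (intro mult_le_mono2)
    show "Suc l ^ 4 \<le> 16 * l ^ 4 + 16"
    proof (cases l)
      case (Suc m)
      then have "Suc l ^ 4 \<le> (2 * l) ^ 4" by (intro power_mono) auto
      then show ?thesis by (simp add: power_mult_distrib)
    qed simp
  qed
  also have "\<dots> = 192 * A * (K + A + 1) * l ^ 4 + 192 * A * (K + A + 1)"
    by (simp add: algebra_simps)
  finally have "k \<le> 192 * A * (K + A + 1) * length x ^ 4 + 192 * A * (K + A + 1)"
    using k by (simp add: l_def)
  moreover have "tape K s = map bit_sym (T x) @ Bl # upper K s 0"
    using tape_split[OF K, of s] s(2) by simp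
  ultimately show "\<exists>k\<le>192 * A * (K + A + 1) * length x ^ 4 + 192 * A * (K + A + 1). \<exists>i j L R.
       (gstep (delta K) halt ^^ k) (([c], Start), replicate i Bl, map bit_sym x @ replicate j Bl)
       = (halt, L, map bit_sym (T x) @ Bl # R)"
    using r by (intro exI[of _ k] conjI exI[of _ "Suc 0"] exI[of _ K] exI[of _ "[Bl]"]
       exI[of _ "upper K s 0 @ replicate j Bl"]) (auto simp: config_def tape_input[OF K])
qed auto

section \<open>Irreducibility of a family of feedback shift registers\<close>

lemma fsr_seqs_iff: "s \<in> fsr_seqs n F \<longleftrightarrow> (\<forall>t. s (t + n) = F (map s [t..<t + n]))"
proof -
  have "take n (map s [t..<Suc (t + n)]) = map s [t..<t + n]" for t
    by (simp add: take_map del: upt_Suc)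
  moreover have "map s [t..<Suc (t + n)] ! n = s (t + n)" for t
    by (simp del: upt_Suc)
  ultimately show ?thesis by (simp add: fsr_seqs_def fsr_char_def del: upt_Suc)
qed

lemma fsr_seq_exists:
  assumes k: "1 \<le> k" and w: "length w = k"
  shows "\<exists>s \<in> fsr_seqs k G. map s [0..<k] = w"
proof -
  define st where "st = (\<lambda>v. tl v @ [G v])"
  define s where "s t = hd ((st ^^ t) w)" for t
  have len: "length ((st ^^ t) w) = k" for t
    by (induction t) (use k w in \<open>auto simp: st_def\<close>)
  have nth: "(st ^^ t) w ! j = s (t + j)" if "j < k" for t j
    using that
  proof (induction j arbitrary: t)
    case 0
    then show ?case using len[of t] by (simp add: s_def hd_conv_nth flip: length_greater_0_conv)
  next
    case (Suc j)
    have "(st ^^ t) w ! Suc j = (st ^^ Suc t) w ! j"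
      using len[of t] Suc.prems by (simp add: st_def nth_append nth_tl less_diff_conv)
    then show ?case using Suc.IH[of "Suc t"] Suc.prems by simp
  qed
  have win: "(st ^^ t) w = map s [t..<t + k]" for t
    by (rule nth_equalityI) (auto simp: len nth)
  have "s (t + k) = G (map s [t..<t + k])" for t
  proof -
    have "s (t + k) = (st ^^ Suc t) w ! (k - 1)"
      using nth[of "k - 1" "Suc t"] k by simp
    also have "\<dots> = G ((st ^^ t) w)" using k len[of t] by (simp add: st_def nth_append)
    finally show ?thesis by (simp add: win)
  qed
  then show ?thesis using win[of 0] by (intro bexI[of _ s]) (auto simp: fsr_seqs_iff)
qed

text \<open>The register has \<open>m + 7\<close> stages. A state of the form \<open>c\<^sub>1 c\<^sub>2 a 1110 d\<close>
with \<open>P a\<close> emits \<open>c\<^sub>1 \<oplus> c\<^sub>2 d\<close>, a state of the form \<open>c\<^sub>2 a 1110 d e\<close> with \<open>P a\<close> emits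
\<open>c\<^sub>2\<close>, and every other state emits \<open>1\<close> exactly if all its bits except possibly the first are
\<open>0\<close>. The bit at position \<open>m + 4\<close> tells the first two forms apart.\<close>

definition payload :: "nat \<Rightarrow> bool list \<Rightarrow> bool list" where
  "payload m x = map (\<lambda>i. if x ! (m + 4) then x ! (i + 2) else x ! (i + 1)) [0..<m]"

text \<open>The marker 1110 begins at m + 2 or at m + 1. Both placements have ones at m + 2 and m +
  3; bit m + 4 is the third one in the first placement and the 0 in the second.\<close>

definition armed :: "nat \<Rightarrow> bool list \<Rightarrow> bool" where
  "armed m x \<longleftrightarrow> x ! (m + 2) \<and> x ! (m + 3) \<and> (if x ! (m + 4) then \<not> x ! (m + 5) else x ! (m + 1))"

definition feedback :: "nat \<Rightarrow> (bool list \<Rightarrow> bool) \<Rightarrow> bool list \<Rightarrow> bool" where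
  "feedback m P x \<longleftrightarrow>
     armed m x \<and> P (payload m x) \<and> (x ! 0 \<noteq> (x ! (m + 4) \<and> x ! 1 \<and> x ! (m + 6)))
     \<or> (\<forall>i\<in>{1..m + 6}. \<not> x ! i)"

lemma feedback_armed:
  assumes "armed m x" "P (payload m x)"
  shows "feedback m P x \<longleftrightarrow> x ! 0 \<noteq> (x ! (m + 4) \<and> x ! 1 \<and> x ! (m + 6))"
proof -
  have "\<exists>i\<in>{1..m + 6}. x ! i"
    by (rule bexI[of _ "m + 2"]) (use assms(1) in \<open>auto simp: armed_def\<close>)
  then show ?thesis using assms unfolding feedback_def by blast
qed

lemma feedback_reducible:
  assumes F: "\<And>x. length x = m + 7 \<Longrightarrow> F x = feedback m P x"
    and P: "\<And>a. length a = m \<Longrightarrow> \<not> P a"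
  shows "fsr_reducible (m + 7) F"
proof -
  have "fsr_seqs (m + 6) (\<lambda>x. \<forall>i<m + 6. \<not> x ! i) \<subseteq> fsr_seqs (m + 7) F"
  proof
    fix s assume s: "s \<in> fsr_seqs (m + 6) (\<lambda>x. \<forall>i<m + 6. \<not> x ! i)"
    show "s \<in> fsr_seqs (m + 7) F"
      unfolding fsr_seqs_iff
    proof
      fix t
      \<comment> \<open>Without a satisfying payload only the last clause remains. It ignores the
        first bit, so at time t it is the rule with m + 6 stages at time t + 1.\<close>
      have eq: "Suc t + (m + 6) = t + (m + 7)" by simp
      have "s (t + (m + 7)) = (\<forall>i<m + 6. \<not> s (Suc t + i))"
        using s[unfolded fsr_seqs_iff, THEN spec, of "Suc t"] unfolding eq by (auto simp del: upt_Suc)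
      moreover have "F (map s [t..<t + (m + 7)]) = (\<forall>i\<in>{1..m + 6}. \<not> s (t + i))"
        using P by (simp add: F feedback_def payload_def del: upt_Suc)
      moreover have "(\<forall>i<m + 6. \<not> s (Suc t + i)) = (\<forall>i\<in>{1..m + 6}. \<not> s (t + i))"
      proof -
        have "{1..m + 6} = Suc ` {..<m + 6}" by (simp add: image_Suc_lessThan)
        then show ?thesis by auto
      qed
      ultimately show "s (t + (m + 7)) = F (map s [t..<t + (m + 7)])" by simp
    qed
  qed
  then show ?thesis unfolding fsr_reducible_def by (intro exI[of _ "m + 6"]) auto
qed

text \<open>Sequences of a register with fewer than \<open>m + 6\<close> stages are excluded because every sequence
of the register contains \<open>m + 6\<close> consecutive zeros: the emitted bits never contain \<open>111\<close>, so after
the initial state has been shifted out only the last clause of the feedback applies.\<close>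
lemma zero_run:
  assumes F: "\<And>x. length x = m + 7 \<Longrightarrow> F x = feedback m P x"
    and s: "s \<in> fsr_seqs (m + 7) F"
  shows "\<exists>t. \<forall>i\<in>{1..m + 6}. \<not> s (t + i)"
proof (rule ccontr)
  assume no: "\<not> ?thesis"
  have rec: "s (t + (m + 7)) = feedback m P (map s [t..<t + (m + 7)])" for t
    using s F by (simp add: fsr_seqs_iff del: upt_Suc)
  have emit: "(s (t + (m + 2)) \<and> s (t + (m + 3)) \<and> s (t + (m + 4)) \<and> \<not> s (t + (m + 5)))
      \<or> (s (t + (m + 1)) \<and> s (t + (m + 2)) \<and> s (t + (m + 3)) \<and> \<not> s (t + (m + 4)))"
    if "s (t + (m + 7))" for t
    using that no unfolding rec[of t] feedback_def armed_def
    by (auto simp del: upt_Suc split: if_splits)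
  \<comment> \<open>Positions are counted from t. The 1 at m + 9 needs a marker whose 0 is at m + 7
    or m + 6; since m + 7 carries a 1, the marker occupies m + 3 to m + 6. But the 1 at m + 7 needs
    a 0 at m + 5 or m + 4, where this marker has ones.\<close>
  have no_run: "\<not> (s (t + (m + 7)) \<and> s (t + (m + 8)) \<and> s (t + (m + 9)))" for t
  proof
    assume r: "s (t + (m + 7)) \<and> s (t + (m + 8)) \<and> s (t + (m + 9))"
    have "s (t + 2 + (m + 7))" using r by (simp add: add.commute add.left_commute)
    then show False
      using emit[of "t + 2"] emit[of t] r
      by (simp add: add.commute add.left_commute eval_nat_numeral)
  qed
  \<comment> \<open>So late, even the three ones of a marker are emitted bits, which
    \<open>no_run\<close> forbids.\<close>
  have "\<not> s (t + (m + 7))" if t: "t \<ge> m + 7" for t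
  proof
    assume "s (t + (m + 7))"
    then consider "s (t + (m + 2)) \<and> s (t + (m + 3)) \<and> s (t + (m + 4))"
      | "s (t + (m + 1)) \<and> s (t + (m + 2)) \<and> s (t + (m + 3))"
      using emit[of t] by blast
    moreover obtain u where "t = u + (m + 7)" using t by (metis add.commute le_iff_add)
    ultimately show False
      using no_run[of "u + (m + 1)"] no_run[of "u + (m + 2)"]
      by (auto simp: add.commute add.left_commute eval_nat_numeral)
  qed
  then have "\<forall>i\<in>{1..m + 6}. \<not> s (2 * (m + 7) + i)"
    by (metis add.commute add.assoc mult_2 le_add1)
  then show False using no by blast
qed

lemma feedback_irreducible:
  assumes F: "\<And>x. length x = m + 7 \<Longrightarrow> F x = feedback m P x"
    and a: "length a = m" "P a"
  shows "fsr_irreducible (m + 7) F"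
  unfolding fsr_irreducible_def fsr_reducible_def
proof (intro notI, elim exE conjE)
  fix k G assume k: "1 \<le> k" "k < m + 7" and sub: "fsr_seqs k G \<subseteq> fsr_seqs (m + 7) F"
  show False
  proof (cases "k = m + 6")
    case True
    \<comment> \<open>The three bits that \<open>G\<close> emits from c1 c2 a 1110, each as a
      function of what is left of the initial state: \<open>H\<close> no longer sees c1, and
      \<open>E\<close> sees neither c1 nor c2.\<close>
    define D where "D c1 c2 = G ([c1, c2] @ a @ [True, True, True, False])" for c1 c2
    define H where "H c2 d = G (c2 # a @ [True, True, True, False, d])" for c2 d
    define E where "E d e = G (a @ [True, True, True, False, d, e])" for d e
    have "H c2 (D c1 c2) = (c1 \<noteq> (c2 \<and> D c1 c2)) \<and> E (D c1 c2) (H c2 (D c1 c2)) = c2" for c1 c2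
    proof -
      let ?w = "[c1, c2] @ a @ [True, True, True, False]"
      obtain s where s: "s \<in> fsr_seqs k G" "map s [0..<k] = ?w"
        using fsr_seq_exists[OF k(1), of ?w G] a True by auto
      have G: "s (t + k) = G (map s [t..<t + k])" for t using s by (simp add: fsr_seqs_iff)
      have sF: "s \<in> fsr_seqs (m + 7) F" using s(1) sub by blast
      have Fs: "s (t + (m + 7)) = feedback m P (map s [t..<t + (m + 7)])" for t
        using sF F by (simp add: fsr_seqs_iff del: upt_Suc)
      let ?d = "s (m + 6)" and ?e = "s (m + 7)"
      have w0: "map s [0..<m + 6] = ?w" using s True by simp
      have w1: "map s [0..<m + 7] = ?w @ [?d]"
        using w0 by (simp add: eval_nat_numeral)
      have w2: "map s [0..<m + 8] = ?w @ [?d, ?e]"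
        using w1 by (simp add: eval_nat_numeral)
      have tl1: "map s [1..<m + 7] = tl (map s [0..<m + 7])"
        by (simp flip: map_tl del: upt_Suc)
      have tl1': "map s [1..<m + 8] = tl (map s [0..<m + 8])"
        by (simp flip: map_tl del: upt_Suc)
      have tl2: "map s [2..<m + 8] = tl (tl (map s [0..<m + 8]))"
        by (simp add: numeral_2_eq_2 flip: map_tl del: upt_Suc)
      have d: "?d = D c1 c2" using G[of 0] w0 by (simp add: True D_def)
      have e: "?e = H c2 ?d" using G[of 1, unfolded True] tl1 w1
        by (simp add: H_def add.commute del: upt_Suc)
      have f: "s (m + 8) = E ?d ?e" using G[of 2, unfolded True] tl2 w2
        by (simp add: E_def add.commute del: upt_Suc)
      have "payload m (?w @ [?d]) = a"
        by (rule nth_equalityI) (auto simp: payload_def a nth_append)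
      then have A: "?e = (c1 \<noteq> (c2 \<and> ?d))"
        using Fs[of 0] w1 a
        by (simp add: feedback_armed armed_def nth_append del: upt_Suc)
      have "payload m (tl (?w @ [?d, ?e])) = a"
        by (rule nth_equalityI) (auto simp: payload_def a nth_append)
      then have B: "s (m + 8) = c2"
        using Fs[of 1] tl1' w2 a
        by (simp add: feedback_armed armed_def nth_append add.commute del: upt_Suc)
      show ?thesis using A B d e f by simp
    qed
    \<comment> \<open>For fixed c2, \<open>H c2 d\<close> equals c1 xor c2 d, so d determines c1;
      hence \<open>D\<close> takes different values for the two values of c1, which gives the form
      c1 xor h(c2). The sixteen value tables of \<open>D\<close> are then checked.\<close>
    from this[of False False] this[of False True] this[of True False] this[of True True]
    show False
      by (cases "D False False"; cases "D False True"; cases "D True False"; cases "D True True") auto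
  next
    case False
    then have k6: "k < m + 6" using k by simp
    obtain s where s: "s \<in> fsr_seqs k G"
      using fsr_seq_exists[OF k(1), of "replicate k False" G] by auto
    then obtain t where "\<forall>i\<in>{1..m + 6}. \<not> s (t + i)" using zero_run[OF F] sub by blast
    then have t: "\<not> s (Suc (t + i))" if "i < m + 6" for i
      using that by (auto dest: bspec[of _ _ "Suc i"])
    have G: "s (t + k) = G (map s [t..<t + k])" for t using s by (simp add: fsr_seqs_iff)
    have "map s [Suc t..<Suc t + k] = replicate k False"
      using t k6 by (intro nth_equalityI) (auto simp del: upt_Suc)
    \<comment> \<open>As k < m + 6, the run contains k zeros that are followed by yet another zero.
      From here on the sequence can never leave 0.\<close>
    then have G0: "\<not> G (replicate k False)"
      using G[of "Suc t"] t k6 by (auto simp del: upt_Suc)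
    have zero: "\<not> s (Suc t + j)" for j
    proof (induction j rule: less_induct)
      case (less j)
      show ?case
      proof (cases "j < k")
        case True
        then show ?thesis using t k6 by auto
      next
        case False
        then obtain i where i: "j = i + k" by (metis add.commute le_iff_add not_less)
        have "map s [Suc t + i..<Suc t + i + k] = replicate k False"
          using less.IH i by (intro nth_equalityI) (auto simp: add.assoc simp del: upt_Suc)
        then show ?thesis using G[of "Suc t + i"] G0 i by (simp add: add.assoc del: upt_Suc)
      qed
    qed
    have "s (Suc t + (m + 7)) = feedback m P (map s [Suc t..<Suc t + (m + 7)])"
      using subsetD[OF sub s, unfolded fsr_seqs_iff, THEN spec, of "Suc t"] F by (simp del: upt_Suc)
    moreover have "feedback m P (map s [Suc t..<Suc t + (m + 7)])"
      unfolding feedback_def using zero by (auto simp del: upt_Suc)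
    ultimately show False using zero by blast
  qed
qed

section \<open>The circuit of the register\<close>

text \<open>\<open>Lin a b c d\<close> stands for the vertex number \<open>a m + b g + c i + d\<close>, where \<open>m\<close> and \<open>g\<close> are the
numbers of inputs and gates of the given circuit and \<open>i\<close> is a loop counter.\<close>

datatype lin = Lin nat nat nat nat

datatype tgate = TAND lin lin | TOR lin lin | TNOT lin

fun lin_val :: "nat \<Rightarrow> nat \<Rightarrow> nat \<Rightarrow> lin \<Rightarrow> nat" where
  "lin_val m g i (Lin a b c d) = a * m + b * g + c * i + d"

fun inst :: "nat \<Rightarrow> nat \<Rightarrow> nat \<Rightarrow> tgate \<Rightarrow> gate" where
  "inst m g i (TAND p q) = AND (lin_val m g i p) (lin_val m g i q)"
| "inst m g i (TOR p q) = OR (lin_val m g i p) (lin_val m g i q)"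
| "inst m g i (TNOT p) = NOT (lin_val m g i p)"

fun shift_gate :: "nat \<Rightarrow> gate \<Rightarrow> gate" where
  "shift_gate k (AND a b) = AND (k + a) (k + b)"
| "shift_gate k (OR a b) = OR (k + a) (k + b)"
| "shift_gate k (NOT a) = NOT (k + a)"

text \<open>The inputs of the new circuit are \<open>0, \<dots>, m + 6\<close>.
Vertices \<open>m + 7, \<dots>, 2m + 11\<close> compute the disjunction of the inputs \<open>1, \<dots>, m + 6\<close>,
vertex \<open>2m + 12\<close> negates input \<open>m + 4\<close>, and the \<open>3m\<close> vertices after it compute the payload, whose
bits are at \<open>4m + 13 + i\<close>. The given circuit is copied behind them, so that each of its vertices
is shifted by \<open>4m + 13\<close>; its output has number \<open>5m + 12 + g\<close>.\<close>

definition head1 :: "tgate list" where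
  "head1 =
    [TOR (Lin 1 0 0 1) (Lin 1 0 0 2), TOR (Lin 1 0 0 3) (Lin 1 0 0 7), TOR (Lin 1 0 0 4) (Lin 1 0 0 8),
     TOR (Lin 1 0 0 5) (Lin 1 0 0 9), TOR (Lin 1 0 0 6) (Lin 1 0 0 10)]"

definition loop1 :: tgate where "loop1 = TOR (Lin 0 0 1 1) (Lin 1 0 1 11)"
definition head2 :: "tgate list" where "head2 = [TNOT (Lin 1 0 0 4)]"
text \<open>Together with \<open>loop3\<close> and \<open>loop4\<close> this is a multiplexer: round
  i selects input i + 2 if input m + 4 is 1, and input i + 1 otherwise.\<close>

definition loop2 :: tgate where "loop2 = TAND (Lin 1 0 0 4) (Lin 0 0 1 2)"
definition loop3 :: tgate where "loop3 = TAND (Lin 2 0 0 12) (Lin 0 0 1 1)"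
definition loop4 :: tgate where "loop4 = TOR (Lin 2 0 1 13) (Lin 3 0 1 13)"

text \<open>Relative to 5 m + g the gates are the vertices 13 to 28, and 12 is the output of the
  copied circuit. Vertex 18 is \<open>armed\<close>, 19 adds the verdict of the copy, 21 is the
  product term, 22 to 25 form its exclusive or with input 0, 27 says that the inputs 1 to m + 6 are
  all 0, and 28 is the output.\<close>

definition tail :: "tgate list" where
  "tail =
    [TNOT (Lin 1 0 0 5),
     TAND (Lin 1 0 0 4) (Lin 5 1 0 13),
     TAND (Lin 2 0 0 12) (Lin 1 0 0 1),
     TOR (Lin 5 1 0 14) (Lin 5 1 0 15),
     TAND (Lin 1 0 0 2) (Lin 1 0 0 3),
     TAND (Lin 5 1 0 16) (Lin 5 1 0 17),
     TAND (Lin 5 1 0 18) (Lin 5 1 0 12),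
     TAND (Lin 1 0 0 4) (Lin 0 0 0 1),
     TAND (Lin 5 1 0 20) (Lin 1 0 0 6),
     TOR (Lin 0 0 0 0) (Lin 5 1 0 21),
     TAND (Lin 0 0 0 0) (Lin 5 1 0 21),
     TNOT (Lin 5 1 0 23),
     TAND (Lin 5 1 0 22) (Lin 5 1 0 24),
     TAND (Lin 5 1 0 19) (Lin 5 1 0 25),
     TNOT (Lin 2 0 0 11),
     TOR (Lin 5 1 0 26) (Lin 5 1 0 27)]"

definition loop_gates :: "nat \<Rightarrow> nat \<Rightarrow> tgate \<Rightarrow> gate list" where
  "loop_gates m g t = map (\<lambda>i. inst m g i t) [0..<m]"

text \<open>No vertex number in these templates contains g, hence the 0 in its place. So the program
  can emit this part before it has counted the gates of the given circuit.\<close>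

definition prelude :: "nat \<Rightarrow> gate list" where
  "prelude m = map (inst m 0 0) head1 @ loop_gates m 0 loop1 @ map (inst m 0 0) head2
     @ loop_gates m 0 loop2 @ loop_gates m 0 loop3 @ loop_gates m 0 loop4"

definition reg_circuit :: "circuit \<Rightarrow> circuit" where
  "reg_circuit C = (let m = fst C; gs = snd C in
     (m + 7, prelude m @ map (shift_gate (4 * m + 13)) gs @ map (inst m (length gs) 0) tail))"

lemmas template_defs = head1_def loop1_def head2_def loop2_def loop3_def loop4_def tail_def

subsection \<open>Evaluation\<close>

definition run :: "gate list \<Rightarrow> bool list \<Rightarrow> bool list" where
  "run gs vs = fold (\<lambda>g vs. vs @ [gate_val g vs]) gs vs"

lemma circ_eval_run: "circ_eval C xs = last (run (snd C) xs)"
  by (simp add: circ_eval_def run_def)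

lemma run_Nil [simp]: "run [] vs = vs"
  and run_Cons [simp]: "run (g # gs) vs = run gs (vs @ [gate_val g vs])"
  and run_append [simp]: "run (gs @ hs) vs = run hs (run gs vs)"
  by (simp_all add: run_def)

lemma length_run [simp]: "length (run gs vs) = length vs + length gs"
  by (induction gs arbitrary: vs) auto

lemma run_prefix: "\<exists>ws. run gs vs = vs @ ws"
proof (induction gs arbitrary: vs)
  case (Cons g gs)
  then show ?case using Cons[of "vs @ [gate_val g vs]"] by auto
qed simp

lemma nth_run_old: "i < length vs \<Longrightarrow> run gs vs ! i = vs ! i"
  using run_prefix[of gs vs] by (auto simp: nth_append)

lemma gate_val_cong:
  "(\<And>a. a \<in> set (gate_args g) \<Longrightarrow> vs ! a = ws ! a) \<Longrightarrow> gate_val g vs = gate_val g ws"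
  by (cases g) auto

text \<open>Entries never change once appended, so a gate may be evaluated on the final list instead
  of the list of its own time.\<close>

lemma nth_run:
  assumes "i < length gs" "\<forall>a\<in>set (gate_args (gs ! i)). a < length vs + i"
  shows "run gs vs ! (length vs + i) = gate_val (gs ! i) (run gs vs)"
proof -
  let ?g = "gs ! i" and ?us = "run (take i gs) vs"
  have gs: "gs = take i gs @ ?g # drop (Suc i) gs" using assms(1) by (rule id_take_nth_drop)
  have r: "run gs vs = run (drop (Suc i) gs) (?us @ [gate_val ?g ?us])"
    by (subst gs) simp
  have len: "length ?us = length vs + i" using assms(1) by simp
  have "run gs vs ! (length vs + i) = gate_val ?g ?us"
    unfolding r using len by (subst nth_run_old) (auto simp: nth_append)
  also have "\<dots> = gate_val ?g (run gs vs)"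
  proof (rule gate_val_cong)
    fix a assume "a \<in> set (gate_args ?g)"
    then have "a < length ?us" using assms(2) len by simp
    then show "?us ! a = run gs vs ! a" unfolding r by (subst nth_run_old) (auto simp: nth_append)
  qed
  finally show ?thesis .
qed

lemma gate_val_shift: "gate_val (shift_gate (length us) g) (us @ vs) = gate_val g vs"
  by (cases g) (auto simp: nth_append)

text \<open>The shifted gates do not see the prefix \<open>us\<close>:
  \<open>(us @ vs) ! (length us + a)\<close> is \<open>vs ! a\<close> for every a, so ill-formed
  circuits are covered too.\<close>

lemma run_shift: "run (map (shift_gate (length us)) gs) (us @ vs) = us @ run gs vs"
  by (induction gs arbitrary: vs) (auto simp: gate_val_shift)


definition operands_ok :: "nat \<Rightarrow> gate list \<Rightarrow> bool" where
  "operands_ok k gs \<longleftrightarrow> (\<forall>i<length gs. \<forall>a\<in>set (gate_args (gs ! i)). a < k + i)"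

text \<open>Turns a run into a system of equations between entries of one list, from which single
  vertex values can be derived in any order.\<close>

definition consistent :: "nat \<Rightarrow> gate list \<Rightarrow> bool list \<Rightarrow> bool" where
  "consistent k gs vs \<longleftrightarrow> (\<forall>i<length gs. vs ! (k + i) = gate_val (gs ! i) vs)"

lemma operands_ok_Nil [simp]: "operands_ok k []"
  by (simp add: operands_ok_def)

lemma operands_ok_Cons [simp]:
  "operands_ok k (g # gs) \<longleftrightarrow> (\<forall>a\<in>set (gate_args g). a < k) \<and> operands_ok (k + 1) gs"
  unfolding operands_ok_def by (simp add: All_less_Suc2)

lemma operands_ok_append:
  "operands_ok k (gs @ hs) \<longleftrightarrow> operands_ok k gs \<and> operands_ok (k + length gs) hs"
  by (induction gs arbitrary: k) auto

lemma operands_ok_loop: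
  "(\<And>i. i < m \<Longrightarrow> \<forall>a\<in>set (gate_args (inst m g i t)). a < k + i) \<Longrightarrow> operands_ok k (loop_gates m g t)"
  by (simp add: operands_ok_def loop_gates_def)

lemma operands_ok_shift: "operands_ok (k + j) (map (shift_gate k) gs) \<longleftrightarrow> operands_ok j gs"
proof (induction gs arbitrary: j)
  case (Cons g gs)
  then show ?case using Cons[of "j + 1"] by (cases g) auto
qed simp

lemma consistent_Nil [simp]: "consistent k [] vs"
  by (simp add: consistent_def)

lemma consistent_Cons [simp]:
  "consistent k (g # gs) vs \<longleftrightarrow> vs ! k = gate_val g vs \<and> consistent (k + 1) gs vs"
  unfolding consistent_def by (simp add: All_less_Suc2)

lemma consistent_append:
  "consistent k (gs @ hs) vs \<longleftrightarrow> consistent k gs vs \<and> consistent (k + length gs) hs vs"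
  by (induction gs arbitrary: k) auto

lemma consistent_loop:
  "consistent k (loop_gates m g t) vs \<longleftrightarrow> (\<forall>i<m. vs ! (k + i) = gate_val (inst m g i t) vs)"
  by (simp add: consistent_def loop_gates_def)

lemma consistent_run: "operands_ok (length xs) gs \<Longrightarrow> consistent (length xs) gs (run gs xs)"
  by (simp add: operands_ok_def consistent_def nth_run)

lemma length_loop_gates [simp]: "length (loop_gates m g t) = m"
  by (simp add: loop_gates_def)

lemma length_prelude: "length (prelude m) = 4 * m + 6"
  by (simp add: prelude_def head1_def head2_def)

lemma length_tail: "length tail = 16"
  by (simp add: tail_def)

lemma operands_ok_prelude: "operands_ok (m + 7) (prelude m)"
  unfolding prelude_def operands_ok_append
  by (auto simp: template_defs intro!: operands_ok_loop)

lemma operands_ok_tail: "operands_ok (5 * m + 13 + g) (map (inst m g 0) tail)"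
  by (simp add: tail_def)

lemma prelude_vals:
  assumes "length xs = m + 7"
  defines "ps \<equiv> run (prelude m) xs"
  shows "ps ! (2 * m + 11) \<longleftrightarrow> (\<exists>i\<in>{1..m + 6}. xs ! i)"
    and "ps ! (2 * m + 12) \<longleftrightarrow> \<not> xs ! (m + 4)"
    and "drop (4 * m + 13) ps = payload m xs"
proof -
  have len: "length ps = 5 * m + 13" by (simp add: ps_def assms length_prelude)
  have old: "ps ! i = xs ! i" if "i < m + 7" for i
    using that assms(1) by (simp add: ps_def nth_run_old)
  have c: "consistent (m + 7) (prelude m) ps"
    using consistent_run[of xs "prelude m"] operands_ok_prelude[of m] assms(1) by (simp add: ps_def)
  have h1: "consistent (m + 7) (map (inst m 0 0) head1) ps"
    and l1: "consistent (m + 12) (loop_gates m 0 loop1) ps"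
    and h2: "consistent (2 * m + 12) (map (inst m 0 0) head2) ps"
    and l2: "consistent (2 * m + 13) (loop_gates m 0 loop2) ps"
    and l3: "consistent (3 * m + 13) (loop_gates m 0 loop3) ps"
    and l4: "consistent (4 * m + 13) (loop_gates m 0 loop4) ps"
    using c unfolding prelude_def consistent_append
    by (simp_all add: head1_def head2_def mult.commute add.commute numeral_Bit0 numeral_Bit1)
  have or5: "ps ! (m + 11) \<longleftrightarrow> (\<exists>i\<in>{m + 1..m + 6}. xs ! i)"
  proof -
    have "ps ! (m + 11) \<longleftrightarrow> xs ! (m + 1) \<or> xs ! (m + 2) \<or> xs ! (m + 3) \<or> xs ! (m + 4)
        \<or> xs ! (m + 5) \<or> xs ! (m + 6)"
      using h1 by (auto simp: head1_def old add.commute)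
    also have "\<dots> \<longleftrightarrow> (\<exists>i\<in>{m + 1, m + 2, m + 3, m + 4, m + 5, m + 6}. xs ! i)" by simp
    also have "{m + 1, m + 2, m + 3, m + 4, m + 5, m + 6} = {m + 1..m + 6}" by auto
    finally show ?thesis .
  qed
  \<comment> \<open>Invariant of the chain built by \<open>loop1\<close>; for i = m the two index
    ranges join.\<close>
  have "ps ! (m + 11 + i) \<longleftrightarrow> (\<exists>j\<in>{1..i} \<union> {m + 1..m + 6}. xs ! j)" if "i \<le> m" for i
    using that
  proof (induction i)
    case 0
    then show ?case using or5 by simp
  next
    case (Suc i)
    have "ps ! (m + 11 + Suc i) \<longleftrightarrow> xs ! Suc i \<or> ps ! (m + 11 + i)"
      using l1[unfolded consistent_loop, rule_format, of i] Suc.prems old[of "Suc i"]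
      by (simp add: loop1_def ac_simps)
    also have "\<dots> \<longleftrightarrow> (\<exists>j\<in>insert (Suc i) {1..i} \<union> {m + 1..m + 6}. xs ! j)"
      using Suc by (simp add: bex_Un)
    also have "insert (Suc i) {1..i} = {1..Suc i}" by auto
    finally show ?case .
  qed
  from this[of m] show "ps ! (2 * m + 11) \<longleftrightarrow> (\<exists>i\<in>{1..m + 6}. xs ! i)"
  proof -
    have "{1..m} \<union> {m + 1..m + 6} = {1..m + 6}" by auto
    moreover have "m + 11 + m = 2 * m + 11" by simp
    ultimately show ?thesis using \<open>m \<le> m \<Longrightarrow> _\<close> by (simp only: order_refl)
  qed
  show nu: "ps ! (2 * m + 12) \<longleftrightarrow> \<not> xs ! (m + 4)"
    using h2 by (simp add: head2_def old)
  show "drop (4 * m + 13) ps = payload m xs"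
  proof (rule nth_equalityI)
    fix i assume "i < length (drop (4 * m + 13) ps)"
    then have i: "i < m" by (simp add: len)
    have "ps ! (4 * m + 13 + i) \<longleftrightarrow> ps ! (2 * m + i + 13) \<or> ps ! (3 * m + i + 13)"
      using l4 i by (simp add: consistent_loop loop4_def)
    moreover have "ps ! (2 * m + i + 13) \<longleftrightarrow> xs ! (m + 4) \<and> xs ! (i + 2)"
      using l2 i by (simp add: consistent_loop loop2_def old add.commute add.left_commute)
    moreover have "ps ! (3 * m + i + 13) \<longleftrightarrow> \<not> xs ! (m + 4) \<and> xs ! (i + 1)"
      using l3 i nu by (simp add: consistent_loop loop3_def old add.commute add.left_commute)
    ultimately show "drop (4 * m + 13) ps ! i = payload m xs ! i"
      using i len by (simp add: payload_def)
  qed (simp add: len payload_def)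
qed

lemma circ_eval_reg_circuit:
  assumes C: "1 \<le> fst C" and x: "length xs = fst C + 7"
  shows "circ_eval (reg_circuit C) xs = feedback (fst C) (circ_eval C) xs"
proof -
  obtain m gs where Cm: "C = (m, gs)" by (cases C)
  have len_xs: "length xs = m + 7" using x by (simp add: Cm)
  define g where "g = length gs"
  define ps where "ps = run (prelude m) xs"
  define us where "us = take (4 * m + 13) ps"
  define ws where "ws = us @ run gs (payload m xs)"
  define vs where "vs = run (map (inst m g 0) tail) ws"
  note pv = prelude_vals[OF len_xs, folded ps_def]
  have len: "length ps = 5 * m + 13" by (simp add: ps_def len_xs length_prelude)
  then have len_us: "length us = 4 * m + 13" by (simp add: us_def)
  \<comment> \<open>The payload comes last, exactly where the shifted copy expects its
    inputs.\<close>
  have ps: "ps = us @ payload m xs" using pv(3) by (metis us_def append_take_drop_id)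
  have len_pay: "length (payload m xs) = m" by (simp add: payload_def)
  have len_ws: "length ws = 5 * m + 13 + g" by (simp add: ws_def len_us len_pay g_def)
  have eval: "circ_eval (reg_circuit C) xs = last vs"
    unfolding circ_eval_run reg_circuit_def vs_def ws_def Cm Let_def snd_conv fst_conv run_append
    by (simp add: g_def ps[symmetric] ps_def[symmetric] flip: run_shift len_us)
  have ps_vs: "vs ! i = ps ! i" if "i < 4 * m + 13" for i
    using that len_us len_ws by (simp add: vs_def nth_run_old ws_def ps nth_append)
  have xs_ps: "ps ! i = xs ! i" if "i < m + 7" for i
    using that len_xs by (simp add: ps_def nth_run_old)
  have xs_vs: "vs ! i = xs ! i" if "i < m + 7" for i
    using that ps_vs xs_ps by simp
  have out: "vs ! (5 * m + g + 12) = circ_eval C (payload m xs)"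
  proof -
    \<comment> \<open>A circuit without gates outputs its last input, which exists because m is
      positive.\<close>
    have "run gs (payload m xs) \<noteq> []" using C len_pay Cm by (metis length_0_conv length_run add_is_0 fst_conv not_one_le_zero)
    moreover have "5 * m + g + 12 < length ws" using len_ws by simp
    moreover have "5 * m + g + 12 = length us + (length (run gs (payload m xs)) - 1)"
      using C Cm len_us len_pay by (simp add: g_def)
    ultimately show ?thesis
      unfolding vs_def using len_ws
      by (subst nth_run_old) (simp_all only: ws_def nth_append_length_plus circ_eval_run Cm last_conv_nth snd_conv not_False_eq_True)
  qed
  have c: "consistent (5 * m + 13 + g) (map (inst m g 0) tail) vs"
    using consistent_run[OF operands_ok_tail[of m g, folded len_ws]] by (simp only: vs_def len_ws)
  have len_vs: "length vs = 5 * m + g + 29" by (simp add: vs_def len_ws length_tail)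
  have "last vs = vs ! (5 * m + g + 28)"
    using len_vs by (subst last_conv_nth) (auto simp: add.commute)
  also have "\<dots> = feedback m (circ_eval C) xs"
    using c out ps_vs[of "2 * m + 11"] ps_vs[of "2 * m + 12"] pv(1,2)
    by (cases "xs ! (m + 4)"; cases "xs ! 0"; cases "xs ! 1"; cases "xs ! (m + 6)")
      (simp_all add: tail_def feedback_def armed_def xs_vs ac_simps)
  finally show ?thesis unfolding eval by (simp only: Cm fst_conv)
qed


subsection \<open>Well-formedness\<close>

definition used :: "gate list \<Rightarrow> nat set" where
  "used gs = (\<Union>g\<in>set gs. set (gate_args g))"

lemma used_simps [simp]:
  "used [] = {}" "used (g # gs) = set (gate_args g) \<union> used gs" "used (gs @ hs) = used gs \<union> used hs"
  by (auto simp: used_def)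

lemma used_loop: "used (loop_gates m g t) = (\<Union>i<m. set (gate_args (inst m g i t)))"
  by (auto simp: used_def loop_gates_def)

lemma used_shift: "used (map (shift_gate k) gs) = (+) k ` used gs"
proof -
  have "set (gate_args (shift_gate k g)) = (+) k ` set (gate_args g)" for g by (cases g) auto
  then show ?thesis by (auto simp: used_def)
qed

lemma circ_wf_iff:
  "circ_wf C \<longleftrightarrow> 1 \<le> fst C \<and> operands_ok (fst C) (snd C) \<and> {..<fst C + length (snd C) - 1} \<subseteq> used (snd C)"
  unfolding circ_wf_def Let_def operands_ok_def used_def subset_iff
  by (auto simp: in_set_conv_nth Bex_def) blast+

lemma used_loop1: "used (loop_gates m g loop1) = {1..<m + 1} \<union> {m + 11..<2 * m + 11}"
proof -
  have "v \<in> (\<Union>i<m. {i + 1})" if "v \<in> {1..<m + 1}" for v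
    using that by (intro UN_I[of "v - 1"]) auto
  moreover have "v \<in> (\<Union>i<m. {m + i + 11})" if "v \<in> {m + 11..<2 * m + 11}" for v
    using that by (intro UN_I[of "v - (m + 11)"]) auto
  ultimately show ?thesis by (force simp: used_loop loop1_def)
qed

lemma used_loop4: "used (loop_gates m g loop4) = {2 * m + 13..<4 * m + 13}"
proof -
  have "v \<in> (\<Union>i<m. {2 * m + i + 13, 3 * m + i + 13})" if "v \<in> {2 * m + 13..<4 * m + 13}" for v
  proof (cases "v < 3 * m + 13")
    case True
    then show ?thesis using that by (intro UN_I[of "v - (2 * m + 13)"]) auto
  next
    case False
    then show ?thesis using that by (intro UN_I[of "v - (3 * m + 13)"]) auto
  qed
  then show ?thesis by (force simp: used_loop loop4_def)
qed

lemma used_head1: "used (map (inst m g 0) head1) = {m + 1..<m + 11}"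
proof
  show "used (map (inst m g 0) head1) \<subseteq> {m + 1..<m + 11}" by (simp add: head1_def)
  \<comment> \<open>The interval is rewritten as a translate of one with numeral bounds, which
    simplification can enumerate.\<close>
  have "v - (m + 1) \<in> {..<10}" if "v \<in> {m + 1..<m + 11}" for v using that by auto
  then have "{m + 1..<m + 11} \<subseteq> (+) (m + 1) ` {..<10}" by (force simp: image_iff)
  then show "{m + 1..<m + 11} \<subseteq> used (map (inst m g 0) head1)"
    by (rule subset_trans) (simp add: head1_def lessThan_nat_numeral lessThan_Suc ac_simps)
qed

lemma used_tail:
  "used (map (inst m g 0) tail)
   = {0, 1, 2 * m + 11, 2 * m + 12} \<union> {m + 1..<m + 7} \<union> {5 * m + g + 12..<5 * m + g + 28}"
  (is "?L = ?R")
proof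
  show "?L \<subseteq> ?R" by (simp add: tail_def)
  have "v - (5 * m + g + 12) \<in> {..<16}" if "v \<in> {5 * m + g + 12..<5 * m + g + 28}" for v using that by auto
  then have 1: "{5 * m + g + 12..<5 * m + g + 28} \<subseteq> (+) (5 * m + g + 12) ` {..<16}" by (force simp: image_iff)
  have "v - (m + 1) \<in> {..<6}" if "v \<in> {m + 1..<m + 7}" for v using that by auto
  then have 2: "{m + 1..<m + 7} \<subseteq> (+) (m + 1) ` {..<6}" by (force simp: image_iff)
  have "{0, 1, 2 * m + 11, 2 * m + 12} \<union> (+) (m + 1) ` {..<6} \<union> (+) (5 * m + g + 12) ` {..<16} \<subseteq> ?L"
    by (simp add: tail_def lessThan_nat_numeral lessThan_Suc ac_simps)
  then show "?R \<subseteq> ?L" using 1 2 by blast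
qed

text \<open>Below the sink 5 m + g + 28 this leaves only the vertices 4 m + 13 to 5 m + g + 11, the
  copies of all vertices of the given circuit except its output. They must be fed into gates of the
  copy itself, which is the condition on the given circuit.\<close>

lemma used_prelude_tail:
  assumes "1 \<le> m"
  shows "used (prelude m) \<union> used (map (inst m g 0) tail)
     = {..<4 * m + 13} \<union> {5 * m + g + 12..<5 * m + g + 28}"
proof -
  define X where "X = used (map (inst m 0 0) head2) \<union> used (loop_gates m 0 loop2) \<union> used (loop_gates m 0 loop3)"
  define Y where "Y = {0, 1, 2 * m + 11, 2 * m + 12} \<union> {m + 1..<m + 7} \<union> {1..<m + 1} \<union> {m + 11..<2 * m + 11}
    \<union> {m + 1..<m + 11} \<union> {2 * m + 13..<4 * m + 13}"
  have "X \<subseteq> {..<4 * m + 13}"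
    by (auto simp: X_def head2_def used_loop loop2_def loop3_def)
  moreover have "Y = {..<4 * m + 13}" using assms unfolding Y_def by auto
  moreover have "used (prelude m) \<union> used (map (inst m g 0) tail) = X \<union> Y \<union> {5 * m + g + 12..<5 * m + g + 28}"
    unfolding prelude_def used_simps used_loop1 used_loop4 used_head1 used_tail X_def Y_def
    by (simp only: Un_ac)
  ultimately show ?thesis by (simp add: Un_absorb1)
qed

lemma circ_wf_reg_circuit:
  assumes "1 \<le> fst C"
  shows "circ_wf (reg_circuit C) \<longleftrightarrow> circ_wf C"
proof -
  obtain m gs where C: "C = (m, gs)" by (cases C)
  define g where "g = length gs"
  have m: "1 \<le> m" using assms C by simp
  let ?gs = "snd (reg_circuit C)"
  have gs: "?gs = prelude m @ map (shift_gate (4 * m + 13)) gs @ map (inst m g 0) tail"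
    by (simp add: reg_circuit_def C g_def Let_def)
  have fst: "fst (reg_circuit C) = m + 7" by (simp add: reg_circuit_def C Let_def)
  have eqs: "m + 7 + length (prelude m) = 4 * m + 13 + m" "4 * m + 13 + m + length gs = 5 * m + 13 + g"
    by (simp_all add: length_prelude g_def)
  have "operands_ok (m + 7) ?gs \<longleftrightarrow> operands_ok m gs"
    unfolding gs operands_ok_append length_map eqs operands_ok_shift
    using operands_ok_prelude operands_ok_tail by simp
  moreover have "{..<m + 7 + length ?gs - 1} \<subseteq> used ?gs \<longleftrightarrow> {..<m + g - 1} \<subseteq> used gs"
  proof -
    have "m + 7 + length ?gs - 1 = 5 * m + g + 28"
      by (simp add: gs length_prelude length_tail g_def)
    moreover have "used ?gs = {..<4 * m + 13} \<union> {5 * m + g + 12..<5 * m + g + 28} \<union> (+) (4 * m + 13) ` used gs"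
      using used_prelude_tail[OF m, of g] by (auto simp: gs used_shift)
    moreover have "{..<5 * m + g + 28} \<subseteq> {..<4 * m + 13} \<union> {5 * m + g + 12..<5 * m + g + 28} \<union> (+) (4 * m + 13) ` U
      \<longleftrightarrow> {..<m + g - 1} \<subseteq> U" for U
    proof
      assume sub: "{..<5 * m + g + 28} \<subseteq> {..<4 * m + 13} \<union> {5 * m + g + 12..<5 * m + g + 28} \<union> (+) (4 * m + 13) ` U"
      show "{..<m + g - 1} \<subseteq> U"
      proof
        fix v assume v: "v \<in> {..<m + g - 1}"
        then have "4 * m + 13 + v \<in> {..<5 * m + g + 28}" by auto
        then have "4 * m + 13 + v \<in> (+) (4 * m + 13) ` U" using subsetD[OF sub] v by fastforce
        then show "v \<in> U" by auto
      qed
    next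
      assume sub: "{..<m + g - 1} \<subseteq> U"
      show "{..<5 * m + g + 28} \<subseteq> {..<4 * m + 13} \<union> {5 * m + g + 12..<5 * m + g + 28} \<union> (+) (4 * m + 13) ` U"
      proof
        fix v assume v: "v \<in> {..<5 * m + g + 28}"
        show "v \<in> {..<4 * m + 13} \<union> {5 * m + g + 12..<5 * m + g + 28} \<union> (+) (4 * m + 13) ` U"
        proof (cases "4 * m + 13 \<le> v \<and> v < 5 * m + g + 12")
          case True
          then have "v - (4 * m + 13) \<in> U" using sub by auto
          then have "4 * m + 13 + (v - (4 * m + 13)) \<in> (+) (4 * m + 13) ` U" by (rule imageI)
          then show ?thesis using True by simp
        qed (use v in auto)
      qed
    qed
    ultimately show ?thesis by (simp only:)
  qed
  ultimately show ?thesis unfolding circ_wf_iff fst using m by (simp add: C g_def)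
qed


lemma fst_reg_circuit: "fst (reg_circuit C) = fst C + 7"
  by (simp add: reg_circuit_def Let_def)

lemma reg_circuit_irreducible:
  assumes "1 \<le> fst C"
  shows "fsr_irreducible (fst (reg_circuit C)) (circ_eval (reg_circuit C)) \<longleftrightarrow> circ_satisfiable C"
proof -
  note F = circ_eval_reg_circuit[OF assms]
  show ?thesis
    unfolding fst_reg_circuit circ_satisfiable_def
    using feedback_reducible[where P = "circ_eval C" and m = "fst C", OF F]
      feedback_irreducible[where P = "circ_eval C" and m = "fst C", OF F]
    by (metis fsr_irreducible_def)
qed

subsection \<open>Encodings\<close>

text \<open>With arbitrary continuations this says that the code is prefix-free, as needed to split
  concatenated codes.\<close>

lemma enc_nat_inj: "enc_nat a @ xs = enc_nat b @ ys \<longleftrightarrow> a = b \<and> xs = ys"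
proof (induction a arbitrary: b)
  case 0
  then show ?case by (cases b) (auto simp: enc_nat_def)
next
  case (Suc a)
  then show ?case by (cases b) (auto simp: enc_nat_def)
qed

lemma enc_gate_inj: "enc_gate g @ xs = enc_gate h @ ys \<longleftrightarrow> g = h \<and> xs = ys"
  by (cases g; cases h) (auto simp: enc_nat_inj)

abbreviation enc_gates :: "gate list \<Rightarrow> bool list" where
  "enc_gates gs \<equiv> concat (map enc_gate gs) @ [True, True]"

text \<open>No gate has the tag 11, so it can mark the end of the list.\<close>

lemma enc_gate_not_end: "enc_gate g @ xs \<noteq> True # True # ys"
  by (cases g) auto

lemma enc_gates_inj: "enc_gates gs @ xs = enc_gates hs @ ys \<longleftrightarrow> gs = hs \<and> xs = ys"
proof (induction gs arbitrary: hs)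
  case Nil
  then show ?case by (cases hs) (auto simp: enc_gate_not_end enc_gate_not_end[symmetric])
next
  case (Cons g gs)
  then show ?case
    using enc_gate_not_end[of g "enc_gates gs @ xs"]
    by (cases hs) (auto simp: enc_gate_inj)
qed

lemma enc_circuit_eq: "enc_circuit C = enc_nat (fst C) @ enc_gates (snd C)"
  by (simp add: enc_circuit_def)

lemma enc_circuit_inj: "enc_circuit C = enc_circuit D \<longleftrightarrow> C = D"
  using enc_gates_inj[of "snd C" "[]" "snd D" "[]"]
  by (auto simp: enc_circuit_eq enc_nat_inj prod_eq_iff)

text \<open>Strings that encode no circuit go to the empty string, which encodes none either. The
  case m = 0 has to be rejected here: the new circuit has m + 7 inputs and would not inherit this
  defect. The choice is unique by \<open>enc_circuit_inj\<close>.\<close>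

definition reduction :: "bool list \<Rightarrow> bool list" where
  "reduction x = (if \<exists>C. x = enc_circuit C \<and> 1 \<le> fst C
     then enc_circuit (reg_circuit (SOME C. x = enc_circuit C)) else [])"

lemma reduction_enc: "1 \<le> fst C \<Longrightarrow> reduction (enc_circuit C) = enc_circuit (reg_circuit C)"
  by (auto simp: reduction_def enc_circuit_inj)

lemma reduction_correct: "x \<in> CIRCUIT_SAT \<longleftrightarrow> reduction x \<in> FSR_IRREDUCIBILITY"
proof (cases "\<exists>C. x = enc_circuit C \<and> 1 \<le> fst C")
  case True
  then obtain C where x: "x = enc_circuit C" and C: "1 \<le> fst C" by blast
  have "x \<in> CIRCUIT_SAT \<longleftrightarrow> circ_wf C \<and> circ_satisfiable C"
    unfolding CIRCUIT_SAT_def x mem_Collect_eq enc_circuit_inj by blast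
  also have "\<dots> \<longleftrightarrow> circ_wf (reg_circuit C) \<and> fsr_irreducible (fst (reg_circuit C)) (circ_eval (reg_circuit C))"
    using circ_wf_reg_circuit[OF C] reg_circuit_irreducible[OF C] by simp
  also have "\<dots> \<longleftrightarrow> reduction x \<in> FSR_IRREDUCIBILITY"
    unfolding x reduction_enc[OF C] FSR_IRREDUCIBILITY_def mem_Collect_eq enc_circuit_inj by blast
  finally show ?thesis .
next
  case False
  then have "x \<notin> CIRCUIT_SAT" by (auto simp: CIRCUIT_SAT_def circ_wf_def Let_def)
  moreover have "[] \<notin> FSR_IRREDUCIBILITY" by (auto simp: FSR_IRREDUCIBILITY_def enc_circuit_def)
  ultimately show ?thesis unfolding reduction_def if_not_P[OF False] by blast
qed

section \<open>A program for the reduction\<close>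

lemma exec_mono: "exec c s n s' \<Longrightarrow> n \<le> n' \<Longrightarrow> exec c s n' s'"
proof (induction arbitrary: n' rule: exec.induct)
  case (Seq c s m s' d n s'' k)
  then show ?case by (meson exec.Seq less_le_trans)
next
  case (IfT s i A c n s' k d)
  then show ?case by (meson exec.IfT less_le_trans)
next
  case (IfF s i A d n s' k c)
  then show ?case by (meson exec.IfF less_le_trans)
next
  case (WhileT s i A c m s' n s'' k)
  then show ?case by (meson exec.WhileT less_le_trans)
qed (auto intro: exec.intros)

text \<open>This and the following rules carry the least admissible bound, so that composing them
  computes a running time; \<open>exec_mono\<close> relaxes it at the end.\<close>

lemma exec_push: "s' = s(i := b # s i) \<Longrightarrow> exec (PUSH i b) s (Suc 0) s'"
  by (simp add: exec.Push)

lemma exec_pop: "s' = s(i := tl (s i)) \<Longrightarrow> exec (POP i) s (Suc 0) s'"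
  by (simp add: exec.Pop)

lemma exec_seq: "exec c s m s' \<Longrightarrow> exec d s' n s'' \<Longrightarrow> exec (SEQ c d) s (Suc (m + n)) s''"
  by (rule exec.Seq) auto

lemma exec_ifT: "exec c s n s' \<Longrightarrow> top (s i) \<in> A \<Longrightarrow> exec (IF i A c d) s (Suc n) s'"
  by (rule exec.IfT) auto

lemma exec_ifF: "exec d s n s' \<Longrightarrow> top (s i) \<notin> A \<Longrightarrow> exec (IF i A c d) s (Suc n) s'"
  by (rule exec.IfF) auto

lemma exec_whileF: "top (s i) \<notin> A \<Longrightarrow> s' = s \<Longrightarrow> exec (WHILE i A c) s (Suc 0) s'"
  by (auto intro: exec.WhileF)

lemma exec_whileT:
  "exec c s m s' \<Longrightarrow> exec (WHILE i A c) s' n s'' \<Longrightarrow> top (s i) \<in> A \<Longrightarrow> exec (WHILE i A c) s (Suc (m + n)) s''"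
  by (rule exec.WhileT) auto

lemma bit_sym_simps [simp]: "bit_sym True = B1" "bit_sym False = B0"
  by (simp_all add: bit_sym_def)

text \<open>Stack 0 holds the input and finally the output, stack 1 the reversed output under
construction; stacks 2 to 5 hold the numbers \<open>m\<close>, \<open>g\<close>, \<open>i\<close> and a loop counter in unary, stack 6 is
scratch space, and stack 7 is a flag: it holds \<open>True\<close> while gates are being read and \<open>False\<close> after
a failure.\<close>

definition mk :: "bool list \<Rightarrow> bool list \<Rightarrow> nat \<Rightarrow> nat \<Rightarrow> nat \<Rightarrow> nat \<Rightarrow> bool list \<Rightarrow> stacks" where
  "mk x out m g i j f = (\<lambda>_. [])(0 := x, 1 := out, 2 := replicate m True, 3 := replicate g True,
     4 := replicate i True, 5 := replicate j True, 7 := f)"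

lemma mk_apply [simp]:
  "mk x out m g i j f 0 = x" "mk x out m g i j f (Suc 0) = out"
  "mk x out m g i j f 2 = replicate m True" "mk x out m g i j f 3 = replicate g True"
  "mk x out m g i j f 4 = replicate i True" "mk x out m g i j f 5 = replicate j True"
  "mk x out m g i j f 6 = []" "mk x out m g i j f 7 = f"
  by (simp_all add: mk_def)

lemma mk_upd [simp]:
  "(mk x out m g i j f)(0 := y) = mk y out m g i j f"
  "(mk x out m g i j f)(Suc 0 := y) = mk x y m g i j f"
  "(mk x out m g i j f)(2 := replicate k True) = mk x out k g i j f"
  "(mk x out m g i j f)(3 := replicate k True) = mk x out m k i j f"
  "(mk x out m g i j f)(4 := replicate k True) = mk x out m g k j f"
  "(mk x out m g i j f)(5 := replicate k True) = mk x out m g i k f"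
  "(mk x out m g i j f)(7 := y) = mk x out m g i j y"
  by (auto simp: mk_def fun_eq_iff)

lemma mk_push [simp]:
  "(mk x out m g i j f)(2 := True # replicate k True) = mk x out (Suc k) g i j f"
  "(mk x out m g i j f)(3 := True # replicate k True) = mk x out m (Suc k) i j f"
  "(mk x out m g i j f)(4 := True # replicate k True) = mk x out m g (Suc k) j f"
  "(mk x out m g i j f)(5 := True # replicate k True) = mk x out m g i (Suc k) f"
  by (simp_all flip: replicate_Suc)

lemma input_mk: "input x = mk x [] 0 0 0 0 []"
  by (auto simp: input_def mk_def fun_eq_iff)

section \<open>Programs that emit pieces of the new circuit\<close>

definition COPY :: "nat \<Rightarrow> nat \<Rightarrow> com" where
  "COPY r d = SEQ (WHILE r {B1} (SEQ (POP r) (SEQ (PUSH d True) (PUSH 6 True))))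
     (WHILE 6 {B1} (SEQ (POP 6) (PUSH r True)))"

text \<open>Reading a stack empties it. Hence the first loop fills d and the scratch stack 6
  together, and the second one restores r from 6.\<close>

lemma exec_copy:
  assumes "r \<noteq> d" "r \<noteq> 6" "d \<noteq> 6" "s r = replicate k True" "s 6 = []"
    and s': "s' = s(d := replicate k True @ s d)"
  shows "exec (COPY r d) s (10 * k + 3) s'"
proof -
  have 1: "exec (WHILE r {B1} (SEQ (POP r) (SEQ (PUSH d True) (PUSH 6 True)))) s (6 * k + 1)
      (s(r := [], d := replicate k True @ s d, 6 := replicate k True @ s 6))"
    if "s r = replicate k True" for s
    using that
  proof (induction k arbitrary: s)
    case 0
    then show ?case using assms(1-3) by (auto intro!: exec_whileF simp: fun_eq_iff)
  next
    case (Suc k)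
    let ?s = "s(r := replicate k True, d := True # s d, 6 := True # s 6)"
    have b: "exec (SEQ (POP r) (SEQ (PUSH d True) (PUSH 6 True))) s 5 ?s"
      by (rule exec_mono[OF exec_seq[OF exec_pop[OF refl] exec_seq[OF exec_push[OF refl] exec_push]]])
         (use Suc.prems assms(1-3) in \<open>auto simp: fun_eq_iff\<close>)
    have "?s r = replicate k True" using assms(1-3) by simp
    note w = Suc.IH[of ?s, OF this]
    have eq: "?s(r := [], d := replicate k True @ ?s d, 6 := replicate k True @ ?s 6)
        = s(r := [], d := replicate (Suc k) True @ s d, 6 := replicate (Suc k) True @ s 6)"
      using assms(1-3) by (auto simp: fun_eq_iff replicate_app_Cons_same)
    show ?case
      by (rule exec_mono[OF exec_whileT[OF b w[unfolded eq]]]) (use Suc.prems in auto)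
  qed
  have 2: "exec (WHILE 6 {B1} (SEQ (POP 6) (PUSH r True))) s (4 * k + 1)
      (s(6 := [], r := replicate k True @ s r))" if "s 6 = replicate k True" for s
    using that
  proof (induction k arbitrary: s)
    case 0
    then show ?case using assms(2) by (auto intro!: exec_whileF simp: fun_eq_iff)
  next
    case (Suc k)
    let ?s = "s(6 := replicate k True, r := True # s r)"
    have b: "exec (SEQ (POP 6) (PUSH r True)) s 3 ?s"
      by (rule exec_mono[OF exec_seq[OF exec_pop[OF refl] exec_push]])
         (use Suc.prems assms(2) in \<open>auto simp: fun_eq_iff\<close>)
    have "?s 6 = replicate k True" using assms(2) by simp
    note w = Suc.IH[of ?s, OF this]
    have eq: "?s(6 := [], r := replicate k True @ ?s r) = s(6 := [], r := replicate (Suc k) True @ s r)"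
      using assms(2) by (auto simp: fun_eq_iff replicate_app_Cons_same)
    show ?case
      by (rule exec_mono[OF exec_whileT[OF b w[unfolded eq]]]) (use Suc.prems in auto)
  qed
  let ?s = "s(r := [], d := replicate k True @ s d, 6 := replicate k True @ s 6)"
  have s6: "?s 6 = replicate k True" using assms by simp
  have "?s(6 := [], r := replicate k True @ ?s r) = s'" using assms by (auto simp: fun_eq_iff)
  then show ?thesis
    unfolding COPY_def using exec_seq[OF 1[of s, OF assms(4)] 2[of ?s, OF s6]] by (simp add: exec_mono)
qed

fun REP :: "nat \<Rightarrow> com \<Rightarrow> com" where
  "REP 0 c = SKIP"
| "REP (Suc n) c = SEQ c (REP n c)"

fun EMIT :: "bool list \<Rightarrow> com" where
  "EMIT [] = SKIP"
| "EMIT (b # bs) = SEQ (PUSH (Suc 0) b) (EMIT bs)"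

definition emits :: "com \<Rightarrow> nat \<Rightarrow> nat \<Rightarrow> nat \<Rightarrow> nat \<Rightarrow> bool list \<Rightarrow> nat \<Rightarrow> bool" where
  "emits c m g i j w t \<longleftrightarrow> (\<forall>x out f. exec c (mk x out m g i j f) t (mk x (rev w @ out) m g i j f))"

lemma emits_mono: "emits c m g i j w t \<Longrightarrow> t \<le> t' \<Longrightarrow> emits c m g i j w t'"
  unfolding emits_def by (blast intro: exec_mono)

lemma emits_seq:
  assumes "emits c m g i j v t" "emits d m g i j w u"
  shows "emits (SEQ c d) m g i j (v @ w) (Suc (t + u))"
  unfolding emits_def
proof (intro allI)
  fix x out f
  show "exec (SEQ c d) (mk x out m g i j f) (Suc (t + u)) (mk x (rev (v @ w) @ out) m g i j f)"
    using assms unfolding emits_def rev_append append_assoc by (blast intro: exec_seq)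
qed

lemma emits_skip: "emits SKIP m g i j [] (Suc 0)"
  by (simp add: emits_def exec.Skip)

lemma emits_push: "emits (PUSH (Suc 0) b) m g i j [b] (Suc 0)"
  unfolding emits_def by (auto intro!: exec_push)

lemma emits_bits: "emits (EMIT bs) m g i j bs (2 * length bs + 1)"
proof (induction bs)
  case (Cons b bs)
  show ?case using emits_seq[OF emits_push Cons, of b] by (simp add: emits_mono)
qed (simp add: emits_skip)

lemma emits_rep:
  assumes "emits c m g i j w t"
  shows "emits (REP n c) m g i j (concat (replicate n w)) (n * (t + 1) + 1)"
proof (induction n)
  case (Suc n)
  show ?case unfolding REP.simps replicate_Suc concat.simps
    by (rule emits_mono[OF emits_seq[OF assms Suc]]) simp
qed (simp add: emits_skip)

lemma emits_copy:
  "emits (COPY 2 (Suc 0)) m g i j (replicate m True) (10 * m + 3)"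
  "emits (COPY 3 (Suc 0)) m g i j (replicate g True) (10 * g + 3)"
  "emits (COPY 4 (Suc 0)) m g i j (replicate i True) (10 * i + 3)"
  unfolding emits_def by (auto intro!: exec_copy)

lemma emits_rep_True:
  assumes "emits c m g i j (replicate k True) t"
  shows "emits (REP n c) m g i j (replicate (n * k) True) (n * (t + 1) + 1)"
proof -
  have "concat (replicate n (replicate k True)) = replicate (n * k) True"
    by (induction n) (simp_all add: replicate_add)
  then show ?thesis using emits_rep[OF assms, of n] by simp
qed

lemma emits_rep_push: "emits (REP n (PUSH (Suc 0) True)) m g i j (replicate n True) (2 * n + 1)"
  using emits_rep_True[of "PUSH (Suc 0) True" m g i j 1 "Suc 0" n] emits_push[of True m g i j]
  by (simp add: mult_2)

fun emit_lin :: "lin \<Rightarrow> com" where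
  "emit_lin (Lin a b c d) = SEQ (REP a (COPY 2 (Suc 0))) (SEQ (REP b (COPY 3 (Suc 0)))
     (SEQ (REP c (COPY 4 (Suc 0))) (SEQ (REP d (PUSH (Suc 0) True)) (PUSH (Suc 0) False))))"

text \<open>Costs are counted in units of 10 N + 5, which covers one \<open>COPY\<close> of a number
  up to N with its share of the overhead of \<open>REP\<close>.\<close>

fun lin_weight :: "lin \<Rightarrow> nat" where
  "lin_weight (Lin a b c d) = a + b + c + d + 2"

lemma emits_lin:
  assumes "m \<le> N" "g \<le> N" "i \<le> N"
  shows "emits (emit_lin l) m g i j (enc_nat (lin_val m g i l)) (lin_weight l * (10 * N + 5))"
proof (cases l)
  case (Lin a b c d)
  have "a * (10 * m + 3 + 1) \<le> a * (10 * N + 5)" "b * (10 * g + 3 + 1) \<le> b * (10 * N + 5)"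
    "c * (10 * i + 3 + 1) \<le> c * (10 * N + 5)" "2 * d \<le> d * (10 * N + 5)"
    using assms by (intro mult_le_mono2; simp)+ simp
  moreover have "enc_nat (lin_val m g i l) = replicate (a * m) True @ replicate (b * g) True
      @ replicate (c * i) True @ replicate d True @ [False]"
    by (simp add: Lin enc_nat_def replicate_add)
  moreover note emits_seq[OF emits_rep_True[OF emits_copy(1)[of m g i j], of a]
     emits_seq[OF emits_rep_True[OF emits_copy(2)[of m g i j], of b]
     emits_seq[OF emits_rep_True[OF emits_copy(3)[of m g i j], of c]
     emits_seq[OF emits_rep_push[of d m g i j] emits_push[of False m g i j]]]]]
  moreover have sum: "Suc (A' + 1 + Suc (B' + 1 + Suc (C' + 1 + Suc (D' + 1 + Suc 0)))) \<le> A + B + C + D + 2 * (10 * N + 5)"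
    if "A' \<le> A" "B' \<le> B" "C' \<le> C" "D' \<le> D" for A A' B B' C C' D D' :: nat
    using that by simp
  ultimately show ?thesis
    unfolding Lin emit_lin.simps lin_weight.simps distrib_right by (elim emits_mono ssubst) (rule sum)
qed

fun emit_gate :: "tgate \<Rightarrow> com" where
  "emit_gate (TAND p q) = SEQ (EMIT [False, False]) (SEQ (emit_lin p) (emit_lin q))"
| "emit_gate (TOR p q) = SEQ (EMIT [False, True]) (SEQ (emit_lin p) (emit_lin q))"
| "emit_gate (TNOT p) = SEQ (EMIT [True, False]) (emit_lin p)"

fun gate_weight :: "tgate \<Rightarrow> nat" where
  "gate_weight (TAND p q) = lin_weight p + lin_weight q + 2"
| "gate_weight (TOR p q) = lin_weight p + lin_weight q + 2"
| "gate_weight (TNOT p) = lin_weight p + 2"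

lemma emits_gate:
  assumes "m \<le> N" "g \<le> N" "i \<le> N"
  shows "emits (emit_gate t) m g i j (enc_gate (inst m g i t)) (gate_weight t * (10 * N + 5))"
proof (cases t)
  case (TAND p q)
  show ?thesis
    unfolding TAND emit_gate.simps inst.simps enc_gate.simps gate_weight.simps
    by (rule emits_mono[OF emits_seq[OF emits_bits emits_seq[OF emits_lin[OF assms] emits_lin[OF assms]]]])
      (simp add: add_mult_distrib)
next
  case (TOR p q)
  show ?thesis
    unfolding TOR emit_gate.simps inst.simps enc_gate.simps gate_weight.simps
    by (rule emits_mono[OF emits_seq[OF emits_bits emits_seq[OF emits_lin[OF assms] emits_lin[OF assms]]]])
      (simp add: add_mult_distrib)
next
  case (TNOT p)
  show ?thesis
    unfolding TNOT emit_gate.simps inst.simps enc_gate.simps gate_weight.simps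
    by (rule emits_mono[OF emits_seq[OF emits_bits emits_lin[OF assms]]])
      (simp add: add_mult_distrib)
qed

fun emit_gates :: "tgate list \<Rightarrow> com" where
  "emit_gates [] = SKIP"
| "emit_gates (t # ts) = SEQ (emit_gate t) (emit_gates ts)"

fun gates_weight :: "tgate list \<Rightarrow> nat" where
  "gates_weight [] = 1"
| "gates_weight (t # ts) = gate_weight t + gates_weight ts + 1"

lemma emits_gates:
  assumes "m \<le> N" "g \<le> N" "i \<le> N"
  shows "emits (emit_gates ts) m g i j (concat (map (\<lambda>t. enc_gate (inst m g i t)) ts))
    (gates_weight ts * (10 * N + 5))"
proof (induction ts)
  case Nil
  show ?case by (auto intro: emits_mono[OF emits_skip])
next
  case (Cons t ts)
  show ?case
    unfolding emit_gates.simps list.map concat.simps gates_weight.simps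
    by (rule emits_mono[OF emits_seq[OF emits_gate[OF assms] Cons]]) (simp add: add_mult_distrib)
qed

text \<open>The body needs an increasing i, but only emptiness can be tested: stack 5 counts the
  remaining rounds down while stack 4 counts i up.\<close>

definition LOOP :: "com \<Rightarrow> com" where
  "LOOP c = SEQ (COPY 2 5) (SEQ (WHILE 5 {B1} (SEQ c (SEQ (POP 5) (PUSH 4 True)))) (WHILE 4 {B1} (POP 4)))"

lemma emits_loop:
  assumes "m \<le> N" "g \<le> N"
  shows "emits (LOOP (emit_gate t)) m g 0 0 (concat (map enc_gate (loop_gates m g t)))
    ((gate_weight t + 6) * ((N + 1) * (10 * N + 5)))"
  unfolding emits_def
proof (intro allI)
  fix x out f
  let ?W = "gate_weight t * (10 * N + 5)"
  let ?enc = "\<lambda>i. enc_gate (inst m g i t)"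
  have 1: "exec (COPY 2 5) (mk x out m g 0 0 f) (10 * m + 3) (mk x out m g 0 m f)"
    by (rule exec_copy) auto
  \<comment> \<open>Generalised to a loop in progress, with i rounds done and j to come.\<close>
  have 2: "exec (WHILE 5 {B1} (SEQ (emit_gate t) (SEQ (POP 5) (PUSH 4 True)))) (mk x out m g i j f)
      (j * (?W + 5) + 1) (mk x (rev (concat (map ?enc [i..<i + j])) @ out) m g (i + j) 0 f)"
    if "i + j \<le> N" for i j out
    using that
  proof (induction j arbitrary: i out)
    case 0
    then show ?case by (auto intro!: exec_whileF)
  next
    case (Suc j)
    have e: "exec (emit_gate t) (mk x out m g i (Suc j) f) ?W (mk x (rev (?enc i) @ out) m g i (Suc j) f)"
      using emits_gate[OF assms, of i t "Suc j"] Suc.prems by (simp add: emits_def)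
    have p: "exec (SEQ (POP 5) (PUSH 4 True)) (mk x (rev (?enc i) @ out) m g i (Suc j) f) 3
       (mk x (rev (?enc i) @ out) m g (Suc i) j f)"
      by (rule exec_mono[OF exec_seq[OF exec_pop[OF refl] exec_push]]) simp_all
    have w: "exec (WHILE 5 {B1} (SEQ (emit_gate t) (SEQ (POP 5) (PUSH 4 True))))
       (mk x (rev (?enc i) @ out) m g (Suc i) j f) (j * (?W + 5) + 1)
       (mk x (rev (concat (map ?enc [i..<i + Suc j])) @ out) m g (i + Suc j) 0 f)"
    proof -
      have "[i..<i + Suc j] = i # [Suc i..<Suc i + j]" by (simp add: upt_conv_Cons del: upt_Suc)
      then show ?thesis using Suc.IH[of "Suc i" "rev (?enc i) @ out"] Suc.prems by (simp del: upt_Suc)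
    qed
    show ?case
      by (rule exec_mono[OF exec_whileT[OF exec_seq[OF e p] w]]) auto
  qed
  have 3: "exec (WHILE 4 {B1} (POP 4)) (mk x out m g i 0 f) (2 * i + 1) (mk x out m g 0 0 f)" for i out
  proof (induction i)
    case 0
    then show ?case by (auto intro!: exec_whileF)
  next
    case (Suc i)
    have "exec (POP 4) (mk x out m g (Suc i) 0 f) (Suc 0) (mk x out m g i 0 f)" by (rule exec_pop) simp
    from exec_whileT[OF this Suc] show ?case by (auto elim: exec_mono)
  qed
  have "exec (LOOP (emit_gate t)) (mk x out m g 0 0 f)
     (Suc (10 * m + 3 + Suc (m * (?W + 5) + 1 + (2 * m + 1))))
     (mk x (rev (concat (map ?enc [0..<m])) @ out) m g 0 0 f)"
    unfolding LOOP_def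
    using 2[of 0 m out] 3[of _ m] assms by (intro exec_seq[OF 1] exec_seq[where s' = "mk _ _ m g m 0 f"]) auto
  moreover have "Suc (10 * m + 3 + Suc (m * (?W + 5) + 1 + (2 * m + 1)))
      \<le> (gate_weight t + 6) * ((N + 1) * (10 * N + 5))"
  proof -
    have "m * ?W \<le> N * ?W" using assms by (intro mult_le_mono1) simp
    also have "\<dots> \<le> gate_weight t * ((N + 1) * (10 * N + 5))" by (simp add: algebra_simps)
    finally have "m * ?W \<le> gate_weight t * ((N + 1) * (10 * N + 5))" .
    moreover have "17 * m + 7 \<le> 6 * ((N + 1) * (10 * N + 5))" using assms by (simp add: algebra_simps)
    ultimately show ?thesis unfolding distrib_right distrib_left by linarith
  qed
  ultimately show "exec (LOOP (emit_gate t)) (mk x out m g 0 0 f) ((gate_weight t + 6) * ((N + 1) * (10 * N + 5)))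
     (mk x (rev (concat (map enc_gate (loop_gates m g t))) @ out) m g 0 0 f)"
    by (auto simp: loop_gates_def comp_def elim: exec_mono)
qed

definition emit_prelude :: com where
  "emit_prelude = SEQ (emit_gates head1) (SEQ (LOOP (emit_gate loop1)) (SEQ (emit_gates head2)
     (SEQ (LOOP (emit_gate loop2)) (SEQ (LOOP (emit_gate loop3)) (LOOP (emit_gate loop4))))))"

lemma emits_prelude:
  assumes "m \<le> N"
  shows "emits emit_prelude m 0 0 0 (concat (map enc_gate (prelude m))) (300 * ((N + 1) * (10 * N + 5)))"
proof -
  let ?U = "(N + 1) * (10 * N + 5)"
  have U: "gates_weight ts * (10 * N + 5) \<le> gates_weight ts * ?U" for ts
    by (intro mult_le_mono2) simp
  have g: "emits (emit_gates ts) m 0 0 0 (concat (map enc_gate (map (inst m 0 0) ts))) (gates_weight ts * ?U)" for ts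
    using emits_mono[OF emits_gates[OF assms, of 0 0 ts 0] U] by (simp add: comp_def)
  have l: "emits (LOOP (emit_gate t)) m 0 0 0 (concat (map enc_gate (loop_gates m 0 t))) ((gate_weight t + 6) * ?U)" for t
    using emits_loop[OF assms, of 0 t] by simp
  have "1 \<le> ?U" by simp
  then show ?thesis
    unfolding emit_prelude_def prelude_def map_append concat_append
    by (intro emits_mono[OF emits_seq[OF g emits_seq[OF l emits_seq[OF g emits_seq[OF l emits_seq[OF l l]]]]]])
       (simp add: template_defs)
qed

section \<open>Reading and copying the gates of the given circuit\<close>

definition FAIL :: com where
  "FAIL = SEQ (POP 7) (PUSH 7 False)"

text \<open>\<open>POP\<close> does nothing on an empty stack, so the result is exactly
  \<open>[False]\<close> whether or not a flag was set.\<close>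

lemma exec_fail: "length f \<le> 1 \<Longrightarrow> exec FAIL (mk x out m g i j f) 3 (mk x out m g i j [False])"
  unfolding FAIL_def
  by (rule exec_mono[OF exec_seq[OF exec_pop[OF refl] exec_push]]) (cases f; simp)+

text \<open>Copies one number from input to output, increased by 4 m + 13. Addition in unary is done
  by first emitting 4 m + 13 ones.\<close>

definition PASS :: com where
  "PASS = SEQ (SEQ (REP 4 (COPY 2 (Suc 0))) (REP 13 (PUSH (Suc 0) True)))
     (SEQ (WHILE 0 {B1} (SEQ (POP 0) (PUSH (Suc 0) True)))
       (IF 0 {B0} (SEQ (POP 0) (PUSH (Suc 0) False)) FAIL))"

lemma unary_cases:
  obtains k r where "x = enc_nat k @ r" | "x = replicate (length x) True"
proof -
  have "(\<exists>k r. x = enc_nat k @ r) \<or> x = replicate (length x) True"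
  proof (induction x)
    case (Cons b x)
    show ?case
    proof (cases b)
      case True
      have "b # x = enc_nat (Suc k) @ r" if "x = enc_nat k @ r" for k r
        using True that by (simp add: enc_nat_def)
      moreover have "b # x = replicate (length (b # x)) True" if "x = replicate (length x) True"
        using True that by simp
      ultimately show ?thesis using Cons by blast
    next
      case False
      then have "b # x = enc_nat 0 @ x" by (simp add: enc_nat_def)
      then show ?thesis by blast
    qed
  qed simp
  then show ?thesis using that by blast
qed

lemma exec_pass_ones:
  "r = [] \<or> \<not> hd r \<Longrightarrow> exec (WHILE 0 {B1} (SEQ (POP 0) (PUSH (Suc 0) True)))
     (mk (replicate k True @ r) out m g i j f) (4 * k + 1) (mk r (replicate k True @ out) m g i j f)"
proof (induction k arbitrary: out)
  case 0
  then show ?case by (cases r) (auto intro!: exec_whileF)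
next
  case (Suc k)
  have b: "exec (SEQ (POP 0) (PUSH (Suc 0) True)) (mk (replicate (Suc k) True @ r) out m g i j f) 3
      (mk (replicate k True @ r) (True # out) m g i j f)"
    by (rule exec_mono[OF exec_seq[OF exec_pop[OF refl] exec_push]]) simp_all
  have w: "exec (WHILE 0 {B1} (SEQ (POP 0) (PUSH (Suc 0) True))) (mk (replicate k True @ r) (True # out) m g i j f)
      (4 * k + 1) (mk r (replicate (Suc k) True @ out) m g i j f)"
    using Suc.IH[OF Suc.prems, of "True # out"] by (simp add: replicate_app_Cons_same)
  show ?case by (rule exec_mono[OF exec_whileT[OF b w]]) simp_all
qed

lemma exec_pass:
  assumes N: "m \<le> N" "length x \<le> N" and f: "length f \<le> 1"
  shows exec_pass_ok: "x = enc_nat k @ r \<Longrightarrow> exec PASS (mk x out m g 0 0 f) (11 * (10 * N + 5))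
      (mk r (rev (enc_nat (4 * m + 13 + k)) @ out) m g 0 0 f)"
    and exec_pass_fail: "x = replicate k True \<Longrightarrow> exec PASS (mk x out m g 0 0 f) (11 * (10 * N + 5))
      (mk [] (replicate (4 * m + 13 + k) True @ out) m g 0 0 [False])"
proof -
  let ?shift = "replicate (4 * m) True @ replicate 13 True"
  have "emits (SEQ (REP 4 (COPY 2 (Suc 0))) (REP 13 (PUSH (Suc 0) True))) m g 0 0 ?shift (40 * m + 48)"
    by (rule emits_mono[OF emits_seq[OF emits_rep_True[OF emits_copy(1)] emits_rep_push]]) simp
  then have shift: "exec (SEQ (REP 4 (COPY 2 (Suc 0))) (REP 13 (PUSH (Suc 0) True))) (mk x out m g 0 0 f)
     (40 * m + 48) (mk x (rev ?shift @ out) m g 0 0 f)"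
    unfolding emits_def by blast
  {
    assume x: "x = enc_nat k @ r"
    have 1: "exec (WHILE 0 {B1} (SEQ (POP 0) (PUSH (Suc 0) True))) (mk x (rev ?shift @ out) m g 0 0 f)
       (4 * k + 1) (mk (False # r) (replicate k True @ rev ?shift @ out) m g 0 0 f)"
      using exec_pass_ones[of "False # r" k "rev ?shift @ out"] by (simp add: x enc_nat_def)
    have 2: "exec (IF 0 {B0} (SEQ (POP 0) (PUSH (Suc 0) False)) FAIL)
       (mk (False # r) (replicate k True @ rev ?shift @ out) m g 0 0 f) 4
       (mk r (False # replicate k True @ rev ?shift @ out) m g 0 0 f)"
      by (rule exec_mono[OF exec_ifT[OF exec_seq[OF exec_pop[OF refl] exec_push]]]) simp_all
    have kN: "k \<le> N" using N x by (simp add: enc_nat_def)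
    have eq: "False # replicate k True @ rev ?shift @ out = rev (enc_nat (4 * m + 13 + k)) @ out"
      by (simp add: enc_nat_def add.commute flip: replicate_add append_assoc)
    show "exec PASS (mk x out m g 0 0 f) (11 * (10 * N + 5))
      (mk r (rev (enc_nat (4 * m + 13 + k)) @ out) m g 0 0 f)"
      unfolding PASS_def by (rule exec_mono[OF exec_seq[OF shift exec_seq[OF 1 2[unfolded eq]]]]) (use N kN in simp)
  next
    assume x: "x = replicate k True"
    have 1: "exec (WHILE 0 {B1} (SEQ (POP 0) (PUSH (Suc 0) True))) (mk x (rev ?shift @ out) m g 0 0 f)
       (4 * k + 1) (mk [] (replicate k True @ rev ?shift @ out) m g 0 0 f)"
      using exec_pass_ones[of "[]" k "rev ?shift @ out"] by (simp add: x)
    have 2: "exec (IF 0 {B0} (SEQ (POP 0) (PUSH (Suc 0) False)) FAIL)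
       (mk [] (replicate k True @ rev ?shift @ out) m g 0 0 f) 4
       (mk [] (replicate k True @ rev ?shift @ out) m g 0 0 [False])"
      by (rule exec_mono[OF exec_ifF[OF exec_fail[OF f]]]) simp_all
    have kN: "k \<le> N" using N x by simp
    have eq: "replicate k True @ rev ?shift @ out = replicate (4 * m + 13 + k) True @ out"
      by (simp add: add.commute flip: replicate_add append_assoc)
    show "exec PASS (mk x out m g 0 0 f) (11 * (10 * N + 5))
      (mk [] (replicate (4 * m + 13 + k) True @ out) m g 0 0 [False])"
      unfolding PASS_def by (rule exec_mono[OF exec_seq[OF shift exec_seq[OF 1[unfolded eq] 2[unfolded eq]]]]) (use N kN in simp)
  }
qed

text \<open>A failure empties stack 0, so that a subsequent attempt to read a number fails as well and the
flag stays \<open>False\<close>.\<close>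

definition READ2 :: "bool list \<Rightarrow> com" where
  "READ2 tag = SEQ (EMIT tag) (SEQ PASS (SEQ PASS (PUSH 3 True)))"

definition READ1 :: "bool list \<Rightarrow> com" where
  "READ1 tag = SEQ (EMIT tag) (SEQ PASS (PUSH 3 True))"

text \<open>A decision tree on the two tag bits. The end code 11 removes the flag and a failure sets
  it to \<open>False\<close>; both stop the loop of \<open>READ_GATES\<close>.\<close>

definition READ_GATE :: com where
  "READ_GATE =
     IF 0 {B0}
       (SEQ (POP 0)
         (IF 0 {B0} (SEQ (POP 0) (READ2 [False, False]))
           (IF 0 {B1} (SEQ (POP 0) (READ2 [False, True])) FAIL)))
       (IF 0 {B1}
         (SEQ (POP 0)
           (IF 0 {B0} (SEQ (POP 0) (READ1 [True, False]))
             (IF 0 {B1} (SEQ (POP 0) (POP 7)) FAIL)))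
         FAIL)"

definition failed :: "nat \<Rightarrow> bool list \<Rightarrow> stacks \<Rightarrow> bool" where
  "failed m x s \<longleftrightarrow> (\<exists>y out g. s = mk y out m g 0 0 [False] \<and> length y \<le> length x)"

lemma failedI: "length y \<le> length x \<Longrightarrow> failed m x (mk y out m g 0 0 [False])"
  unfolding failed_def by blast

lemma failed_empty: "failed m x (mk [] out m g 0 0 [False])"
  by (rule failedI) simp

lemma failed_mono: "failed m x s \<Longrightarrow> length x \<le> length y \<Longrightarrow> failed m y s"
  unfolding failed_def by (blast intro: le_trans)

lemma unary_not_enc_nat: "replicate k True \<noteq> enc_nat b @ r"
proof
  assume eq: "replicate k True = enc_nat b @ r"
  have "False \<in> set (enc_nat b @ r)" by (simp add: enc_nat_def)
  then show False unfolding eq[symmetric] by simp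
qed

lemma exec_push_g: "exec (PUSH 3 True) (mk x out m g i j f) (Suc 0) (mk x out m (Suc g) i j f)"
  by (rule exec_push) simp

lemma exec_bits: "exec (EMIT bs) (mk x out m g i j f) (2 * length bs + 1) (mk x (rev bs @ out) m g i j f)"
  using emits_bits unfolding emits_def by blast

lemma exec_read2:
  assumes N: "m \<le> N" "length x \<le> N" and tag: "length tag = 2"
  shows "(\<exists>a b r. x = enc_nat a @ enc_nat b @ r \<and>
      exec (READ2 tag) (mk x out m g 0 0 [True]) (24 * (10 * N + 5))
       (mk r (rev (tag @ enc_nat (4 * m + 13 + a) @ enc_nat (4 * m + 13 + b)) @ out) m (Suc g) 0 0 [True]))
    \<or> (\<nexists>a b r. x = enc_nat a @ enc_nat b @ r) \<and>
      (\<exists>s. exec (READ2 tag) (mk x out m g 0 0 [True]) (24 * (10 * N + 5)) s \<and> failed m x s)"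
proof -
  let ?P = "11 * (10 * N + 5)"
  have e: "exec (EMIT tag) (mk x out m g 0 0 [True]) 5 (mk x (rev tag @ out) m g 0 0 [True])"
    using exec_bits[of tag] tag by simp
  have compose: "exec (READ2 tag) (mk x out m g 0 0 [True]) (24 * (10 * N + 5)) (mk y' out' m (Suc g) 0 0 f')"
    if "exec PASS (mk x (rev tag @ out) m g 0 0 [True]) ?P s" "exec PASS s ?P (mk y' out' m g 0 0 f')"
    for s y' out' f'
    unfolding READ2_def
    by (rule exec_mono[OF exec_seq[OF e exec_seq[OF that(1) exec_seq[OF that(2) exec_push_g]]]]) simp
  consider (ok) a b r where "x = enc_nat a @ enc_nat b @ r"
    | (fail2) a k where "x = enc_nat a @ replicate k True"
    | (fail1) k where "x = replicate k True"
    by (metis unary_cases)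
  then show ?thesis
  proof cases
    case ok
    have 1: "exec PASS (mk x (rev tag @ out) m g 0 0 [True]) ?P
       (mk (enc_nat b @ r) (rev (enc_nat (4 * m + 13 + a)) @ rev tag @ out) m g 0 0 [True])"
      by (rule exec_pass_ok[OF N _ ok]) simp
    have "exec PASS (mk (enc_nat b @ r) (rev (enc_nat (4 * m + 13 + a)) @ rev tag @ out) m g 0 0 [True]) ?P
       (mk r (rev (enc_nat (4 * m + 13 + b)) @ rev (enc_nat (4 * m + 13 + a)) @ rev tag @ out) m g 0 0 [True])"
      by (rule exec_pass_ok[OF N(1)]) (use N ok in auto)
    from compose[OF 1 this] ok show ?thesis by (intro disjI1 exI[of _ a] exI[of _ b] exI[of _ r]) simp
  next
    case fail2
    have 1: "exec PASS (mk x (rev tag @ out) m g 0 0 [True]) ?P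
       (mk (replicate k True) (rev (enc_nat (4 * m + 13 + a)) @ rev tag @ out) m g 0 0 [True])"
      by (rule exec_pass_ok[OF N _ fail2]) simp
    have 2: "exec PASS (mk (replicate k True) (rev (enc_nat (4 * m + 13 + a)) @ rev tag @ out) m g 0 0 [True]) ?P
       (mk [] (replicate (4 * m + 13 + k) True @ rev (enc_nat (4 * m + 13 + a)) @ rev tag @ out) m g 0 0 [False])"
      by (rule exec_pass_fail[OF N(1)]) (use N fail2 in auto)
    have "x \<noteq> enc_nat a' @ enc_nat b' @ r'" for a' b' r'
      unfolding fail2 enc_nat_inj using unary_not_enc_nat by blast
    then show ?thesis using compose[OF 1 2] failed_empty by blast
  next
    case fail1
    have 1: "exec PASS (mk x (rev tag @ out) m g 0 0 [True]) ?P
       (mk [] (replicate (4 * m + 13 + k) True @ rev tag @ out) m g 0 0 [False])"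
      by (rule exec_pass_fail[OF N _ fail1]) simp
    have 2: "exec PASS (mk [] (replicate (4 * m + 13 + k) True @ rev tag @ out) m g 0 0 [False]) ?P
       (mk [] (replicate (4 * m + 13 + 0) True @ replicate (4 * m + 13 + k) True @ rev tag @ out) m g 0 0 [False])"
      by (rule exec_pass_fail[OF N(1)]) auto
    have "x \<noteq> enc_nat a' @ enc_nat b' @ r'" for a' b' r'
      unfolding fail1 by (rule unary_not_enc_nat)
    then show ?thesis using compose[OF 1 2] failed_empty by blast
  qed
qed

lemma exec_read1:
  assumes N: "m \<le> N" "length x \<le> N" and tag: "length tag = 2"
  shows "(\<exists>a r. x = enc_nat a @ r \<and>
      exec (READ1 tag) (mk x out m g 0 0 [True]) (24 * (10 * N + 5))
       (mk r (rev (tag @ enc_nat (4 * m + 13 + a)) @ out) m (Suc g) 0 0 [True]))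
    \<or> (\<nexists>a r. x = enc_nat a @ r) \<and>
      (\<exists>s. exec (READ1 tag) (mk x out m g 0 0 [True]) (24 * (10 * N + 5)) s \<and> failed m x s)"
proof -
  let ?P = "11 * (10 * N + 5)"
  have e: "exec (EMIT tag) (mk x out m g 0 0 [True]) 5 (mk x (rev tag @ out) m g 0 0 [True])"
    using exec_bits[of tag] tag by simp
  have compose: "exec (READ1 tag) (mk x out m g 0 0 [True]) (24 * (10 * N + 5)) (mk y' out' m (Suc g) 0 0 f')"
    if "exec PASS (mk x (rev tag @ out) m g 0 0 [True]) ?P (mk y' out' m g 0 0 f')" for y' out' f'
    unfolding READ1_def by (rule exec_mono[OF exec_seq[OF e exec_seq[OF that exec_push_g]]]) simp
  show ?thesis
  proof (cases x rule: unary_cases)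
    case (1 a r)
    have "exec PASS (mk x (rev tag @ out) m g 0 0 [True]) ?P
       (mk r (rev (enc_nat (4 * m + 13 + a)) @ rev tag @ out) m g 0 0 [True])"
      by (rule exec_pass_ok[OF N _ 1]) simp
    from compose[OF this] 1 show ?thesis by (intro disjI1 exI[of _ a] exI[of _ r]) simp
  next
    case 2
    have 1: "exec PASS (mk x (rev tag @ out) m g 0 0 [True]) ?P
       (mk [] (replicate (4 * m + 13 + length x) True @ rev tag @ out) m g 0 0 [False])"
      by (rule exec_pass_fail[OF N _ 2]) simp
    have "x \<noteq> enc_nat a' @ r'" for a' r'
      using unary_not_enc_nat[of "length x"] 2 by metis
    then show ?thesis using compose[OF 1] failed_empty by blast
  qed
qed

lemma not_gate_prefix:
  "enc_gate h @ r \<noteq> []" "enc_gate h @ r \<noteq> [b]" "enc_gate h @ r \<noteq> True # True # y"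
  "enc_gate h @ r = False # False # y \<Longrightarrow> \<exists>a b. y = enc_nat a @ enc_nat b @ r"
  "enc_gate h @ r = False # True # y \<Longrightarrow> \<exists>a b. y = enc_nat a @ enc_nat b @ r"
  "enc_gate h @ r = True # False # y \<Longrightarrow> \<exists>a. y = enc_nat a @ r"
  by (cases h; auto)+

lemma exec_popx: "exec (POP 0) (mk (b # x) out m g i j f) (Suc 0) (mk x out m g i j f)"
  by (rule exec_pop) simp

lemma exec_read_gate:
  fixes m g :: nat and out :: "bool list"
  assumes N: "m \<le> N" "length x \<le> N"
  defines "t \<equiv> 30 * (10 * N + 5)" and "s \<equiv> mk x out m g 0 0 [True]"
  shows "(\<exists>r. x = True # True # r \<and> exec READ_GATE s t (mk r out m g 0 0 []))
    \<or> (\<exists>h r. x = enc_gate h @ r \<and>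
        exec READ_GATE s t (mk r (rev (enc_gate (shift_gate (4 * m + 13) h)) @ out) m (Suc g) 0 0 [True]))
    \<or> (\<nexists>r. x = True # True # r) \<and> (\<nexists>h r. x = enc_gate h @ r) \<and>
        (\<exists>s'. exec READ_GATE s t s' \<and> failed m x s')"
proof -
  have fail_t: "20 \<le> t" by (simp add: t_def)
  have len2: "length [b, c :: bool] = 2" for b c by simp
  have read: "24 * (10 * N + 5) + 10 \<le> t" by (simp add: t_def)
  consider (short) "length x \<le> 1" | (ff) y where "x = False # False # y" | (ft) y where "x = False # True # y"
    | (tf) y where "x = True # False # y" | (tt) y where "x = True # True # y"
  proof (cases x rule: remdups_adj.cases)
    case (3 b c y)
    then show ?thesis using that(2-5) by (cases b; cases c) auto
  qed (use that(1) in auto)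
  then show ?thesis
  proof cases
    case short
    have "x \<noteq> enc_gate h @ r" for h r
      using short not_gate_prefix(1)[of h r] not_gate_prefix(2)[of h r "hd x"] by (cases x) auto
    then have none: "(\<nexists>r. x = True # True # r) \<and> (\<nexists>h r. x = enc_gate h @ r)"
      using short by auto
    have "\<exists>s'. exec READ_GATE s t s' \<and> failed m x s'"
    proof (cases x)
      case Nil
      have "exec READ_GATE s t (mk [] out m g 0 0 [False])"
        unfolding READ_GATE_def s_def Nil
        by (rule exec_mono[OF exec_ifF[OF exec_ifF[OF exec_fail]]]) (use fail_t in auto)
      then show ?thesis using failed_empty by blast
    next
      case (Cons b y)
      then have y: "x = [b]" using short by simp
      have "exec READ_GATE s t (mk [] out m g 0 0 [False])"
      proof (cases b)
        case True
        show ?thesis unfolding READ_GATE_def s_def y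
          by (rule exec_mono[OF exec_ifF[OF exec_ifT[OF exec_seq[OF exec_popx exec_ifF[OF exec_ifF[OF exec_fail]]]]]])
            (use fail_t True in auto)
      next
        case False
        show ?thesis unfolding READ_GATE_def s_def y
          by (rule exec_mono[OF exec_ifT[OF exec_seq[OF exec_popx exec_ifF[OF exec_ifF[OF exec_fail]]]]])
            (use fail_t False in auto)
      qed
      then show ?thesis using failed_empty by blast
    qed
    then show ?thesis using none by blast
  next
    case ff
    have sub: "exec READ_GATE s t s'"
      if "exec (READ2 [False, False]) (mk y out m g 0 0 [True]) (24 * (10 * N + 5)) s'" for s'
      unfolding READ_GATE_def s_def ff
      by (rule exec_mono[OF exec_ifT[OF exec_seq[OF exec_popx exec_ifT[OF exec_seq[OF exec_popx that]]]]])
        (use read in auto)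
    have "length y \<le> N" using N ff by simp
    from exec_read2[OF N(1) this len2[of False False], of out g] show ?thesis
    proof (elim disjE exE conjE)
      fix a b r assume y: "y = enc_nat a @ enc_nat b @ r"
        and e: "exec (READ2 [False, False]) (mk y out m g 0 0 [True]) (24 * (10 * N + 5))
          (mk r (rev ([False, False] @ enc_nat (4 * m + 13 + a) @ enc_nat (4 * m + 13 + b)) @ out) m (Suc g) 0 0 [True])"
      show ?thesis
        by (rule disjI2, rule disjI1, rule exI[of _ "AND a b"], rule exI[of _ r])
           (use sub[OF e] in \<open>simp add: ff y\<close>)
    next
      fix s' assume no: "\<nexists>a b r. y = enc_nat a @ enc_nat b @ r"
        and e: "exec (READ2 [False, False]) (mk y out m g 0 0 [True]) (24 * (10 * N + 5)) s'" "failed m y s'"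
      have "failed m x s'" by (rule failed_mono[OF e(2)]) (simp add: ff)
      moreover have "\<nexists>h r. x = enc_gate h @ r" using not_gate_prefix(4) no unfolding ff by metis
      ultimately show ?thesis using sub[OF e(1)] by (auto simp: ff)
    qed
  next
    case ft
    have sub: "exec READ_GATE s t s'"
      if "exec (READ2 [False, True]) (mk y out m g 0 0 [True]) (24 * (10 * N + 5)) s'" for s'
      unfolding READ_GATE_def s_def ft
      by (rule exec_mono[OF exec_ifT[OF exec_seq[OF exec_popx exec_ifF[OF exec_ifT[OF exec_seq[OF exec_popx that]]]]]])
        (use read in auto)
    have "length y \<le> N" using N ft by simp
    from exec_read2[OF N(1) this len2[of False True], of out g] show ?thesis
    proof (elim disjE exE conjE)
      fix a b r assume y: "y = enc_nat a @ enc_nat b @ r"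
        and e: "exec (READ2 [False, True]) (mk y out m g 0 0 [True]) (24 * (10 * N + 5))
          (mk r (rev ([False, True] @ enc_nat (4 * m + 13 + a) @ enc_nat (4 * m + 13 + b)) @ out) m (Suc g) 0 0 [True])"
      show ?thesis
        by (rule disjI2, rule disjI1, rule exI[of _ "OR a b"], rule exI[of _ r])
           (use sub[OF e] in \<open>simp add: ft y\<close>)
    next
      fix s' assume no: "\<nexists>a b r. y = enc_nat a @ enc_nat b @ r"
        and e: "exec (READ2 [False, True]) (mk y out m g 0 0 [True]) (24 * (10 * N + 5)) s'" "failed m y s'"
      have "failed m x s'" by (rule failed_mono[OF e(2)]) (simp add: ft)
      moreover have "\<nexists>h r. x = enc_gate h @ r" using not_gate_prefix(5) no unfolding ft by metis
      ultimately show ?thesis using sub[OF e(1)] by (auto simp: ft)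
    qed
  next
    case tf
    have sub: "exec READ_GATE s t s'"
      if "exec (READ1 [True, False]) (mk y out m g 0 0 [True]) (24 * (10 * N + 5)) s'" for s'
      unfolding READ_GATE_def s_def tf
      by (rule exec_mono[OF exec_ifF[OF exec_ifT[OF exec_seq[OF exec_popx exec_ifT[OF exec_seq[OF exec_popx that]]]]]])
        (use read in auto)
    have "length y \<le> N" using N tf by simp
    from exec_read1[OF N(1) this len2[of True False], of out g] show ?thesis
    proof (elim disjE exE conjE)
      fix a r assume y: "y = enc_nat a @ r"
        and e: "exec (READ1 [True, False]) (mk y out m g 0 0 [True]) (24 * (10 * N + 5))
          (mk r (rev ([True, False] @ enc_nat (4 * m + 13 + a)) @ out) m (Suc g) 0 0 [True])"
      show ?thesis
        by (rule disjI2, rule disjI1, rule exI[of _ "NOT a"], rule exI[of _ r])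
           (use sub[OF e] in \<open>simp add: tf y\<close>)
    next
      fix s' assume no: "\<nexists>a r. y = enc_nat a @ r"
        and e: "exec (READ1 [True, False]) (mk y out m g 0 0 [True]) (24 * (10 * N + 5)) s'" "failed m y s'"
      have "failed m x s'" by (rule failed_mono[OF e(2)]) (simp add: tf)
      moreover have "\<nexists>h r. x = enc_gate h @ r" using not_gate_prefix(6) no unfolding tf by metis
      ultimately show ?thesis using sub[OF e(1)] by (auto simp: tf)
    qed
  next
    case tt
    have "exec READ_GATE s t (mk y out m g 0 0 [])"
      unfolding READ_GATE_def s_def tt
      by (rule exec_mono[OF exec_ifF[OF exec_ifT[OF exec_seq[OF exec_popx exec_ifF[OF exec_ifT[OF exec_seq[OF exec_popx exec_pop]]]]]]])
        (use fail_t in auto)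
    then show ?thesis using tt by blast
  qed
qed

definition READ_GATES :: com where
  "READ_GATES = WHILE 7 {B1} READ_GATE"

text \<open>Each gate read shortens the input, so there are at most \<open>length x + 1\<close>
  rounds. A round takes 31 units: 30 for \<open>READ_GATE\<close> and one for the loop.\<close>

lemma exec_read_gates:
  assumes "m \<le> N" "length x \<le> N"
  shows "(\<exists>gs r. x = enc_gates gs @ r \<and>
        exec READ_GATES (mk x out m g 0 0 [True]) (31 * ((length x + 1) * (10 * N + 5)))
          (mk r (rev (concat (map enc_gate (map (shift_gate (4 * m + 13)) gs))) @ out) m (g + length gs) 0 0 []))
    \<or> (\<nexists>gs r. x = enc_gates gs @ r) \<and>
        (\<exists>s. exec READ_GATES (mk x out m g 0 0 [True]) (31 * ((length x + 1) * (10 * N + 5))) s \<and> failed m x s)"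
  using assms
proof (induction "length x" arbitrary: x out g rule: less_induct)
  case less
  let ?s = "mk x out m g 0 0 [True]" and ?t = "30 * (10 * N + 5)"
  let ?T = "31 * ((length x + 1) * (10 * N + 5))"
  have step: "exec READ_GATES ?s ?T s'"
    if "exec READ_GATE ?s ?t (mk r out' m g' 0 0 [True])" "length r < length x"
      "exec READ_GATES (mk r out' m g' 0 0 [True]) (31 * ((length r + 1) * (10 * N + 5))) s'" for r out' g' s'
  proof -
    have "Suc (?t + 31 * ((length r + 1) * (10 * N + 5))) \<le> 31 * ((length r + 2) * (10 * N + 5))"
      by (simp add: algebra_simps)
    also have "\<dots> \<le> ?T" using that(2) by (intro mult_le_mono2 mult_le_mono1) simp
    finally show ?thesis using exec_whileT[OF that(1) that(3)[unfolded READ_GATES_def]]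
      unfolding READ_GATES_def by (auto elim!: exec_mono)
  qed
  have stop: "exec READ_GATES ?s ?T s'" if "exec READ_GATE ?s ?t s'" "top (s' 7) \<noteq> B1" for s'
  proof -
    have "Suc (?t + Suc 0) \<le> ?T" by (simp add: algebra_simps)
    then show ?thesis using exec_whileT[OF that(1) exec_whileF[of s' 7 "{B1}" s' READ_GATE]] that(2)
      unfolding READ_GATES_def by (auto elim!: exec_mono)
  qed
  from exec_read_gate[OF less.prems, of out g] show ?case
  proof (elim disjE exE conjE)
    fix r assume x: "x = True # True # r" and e: "exec READ_GATE ?s ?t (mk r out m g 0 0 [])"
    have "exec READ_GATES ?s ?T (mk r out m g 0 0 [])" by (rule stop[OF e]) simp
    then show ?thesis using x by (intro disjI1 exI[of _ "[]"] exI[of _ r]) simp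
  next
    fix h r assume x: "x = enc_gate h @ r"
      and e: "exec READ_GATE ?s ?t (mk r (rev (enc_gate (shift_gate (4 * m + 13) h)) @ out) m (Suc g) 0 0 [True])"
    have len: "length r < length x" using x by (cases h) auto
    \<comment> \<open>Gate codes are prefix-free, so h is the only possible first gate, and failure
      on the rest means failure on the whole.\<close>
    have gs_iff: "(\<exists>gs r'. x = enc_gates gs @ r') \<longleftrightarrow> (\<exists>gs r'. r = enc_gates gs @ r')"
    proof
      assume "\<exists>gs r'. x = enc_gates gs @ r'"
      then obtain gs r' where gs: "x = enc_gates gs @ r'" by blast
      then show "\<exists>gs r'. r = enc_gates gs @ r'"
        using enc_gate_not_end[of h r r'] by (cases gs) (auto simp: x enc_gate_inj)
    next
      assume "\<exists>gs r'. r = enc_gates gs @ r'"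
      then obtain gs r' where "r = enc_gates gs @ r'" by blast
      then have "x = enc_gates (h # gs) @ r'" by (simp add: x)
      then show "\<exists>gs r'. x = enc_gates gs @ r'" by blast
    qed
    have "length r \<le> N" using len less.prems(2) by simp
    from less.hyps[OF len less.prems(1) this, of "rev (enc_gate (shift_gate (4 * m + 13) h)) @ out" "Suc g"]
    show ?thesis
    proof (elim disjE exE conjE)
      fix gs r' assume r: "r = enc_gates gs @ r'"
        and f: "exec READ_GATES (mk r (rev (enc_gate (shift_gate (4 * m + 13) h)) @ out) m (Suc g) 0 0 [True])
          (31 * ((length r + 1) * (10 * N + 5)))
          (mk r' (rev (concat (map enc_gate (map (shift_gate (4 * m + 13)) gs)))
            @ rev (enc_gate (shift_gate (4 * m + 13) h)) @ out) m (Suc g + length gs) 0 0 [])"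
      show ?thesis
        by (rule disjI1, rule exI[of _ "h # gs"], rule exI[of _ r']) (use step[OF e len f] in \<open>simp add: x r\<close>)
    next
      fix s' assume no: "\<nexists>gs r'. r = enc_gates gs @ r'"
        and f: "exec READ_GATES (mk r (rev (enc_gate (shift_gate (4 * m + 13) h)) @ out) m (Suc g) 0 0 [True])
          (31 * ((length r + 1) * (10 * N + 5))) s'" "failed m r s'"
      have "failed m x s'" by (rule failed_mono[OF f(2)]) (use len in simp)
      then show ?thesis using step[OF e len f(1)] no gs_iff by blast
    qed
  next
    fix s' assume no: "\<nexists>r. x = True # True # r" "\<nexists>h r. x = enc_gate h @ r"
      and e: "exec READ_GATE ?s ?t s'" "failed m x s'"
    have "exec READ_GATES ?s ?T s'" by (rule stop[OF e(1)]) (use e(2) in \<open>auto simp: failed_def\<close>)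
    moreover have "x \<noteq> enc_gates gs @ r" for gs r
      using no by (cases gs) auto
    ultimately show ?thesis using e(2) by blast
  qed
qed


section \<open>The complete program and its running time\<close>

definition BUILD :: com where
  "BUILD = SEQ (WHILE 0 {B1} (SEQ (POP 0) (PUSH 2 True)))
     (IF 0 {B0}
       (SEQ (POP 0)
         (IF 2 {B1}
           (SEQ (SEQ (emit_lin (Lin 1 0 0 7)) emit_prelude)
             (SEQ (PUSH 7 True)
               (SEQ READ_GATES
                 (IF 7 {B0} SKIP
                   (IF 0 {Bl} (SEQ (emit_gates tail) (EMIT [True, True])) FAIL)))))
           FAIL))
       FAIL)"

lemma exec_read_ones:
  "r = [] \<or> \<not> hd r \<Longrightarrow> exec (WHILE 0 {B1} (SEQ (POP 0) (PUSH 2 True)))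
     (mk (replicate k True @ r) out m g i j f) (4 * k + 1) (mk r out (m + k) g i j f)"
proof (induction k arbitrary: m)
  case 0
  then show ?case by (cases r) (auto intro!: exec_whileF)
next
  case (Suc k)
  have b: "exec (SEQ (POP 0) (PUSH 2 True)) (mk (replicate (Suc k) True @ r) out m g i j f) 3
      (mk (replicate k True @ r) out (Suc m) g i j f)"
    by (rule exec_mono[OF exec_seq[OF exec_pop[OF refl] exec_push]]) simp_all
  have w: "exec (WHILE 0 {B1} (SEQ (POP 0) (PUSH 2 True))) (mk (replicate k True @ r) out (Suc m) g i j f)
      (4 * k + 1) (mk r out (m + Suc k) g i j f)"
    using Suc.IH[OF Suc.prems, of "Suc m"] by simp
  show ?case by (rule exec_mono[OF exec_whileT[OF b w]]) simp_all
qed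

text \<open>\<open>tail\<close> is emitted after reading because its vertex numbers contain g, which
  is counted meanwhile. Input left over behind the end code is a failure as well.\<close>

lemma exec_build:
  defines "U \<equiv> \<lambda>x. (length x + 1) * (10 * length x + 5)"
  shows "\<exists>s. exec BUILD (input x) (1400 * U x) s \<and>
     (s 7 = [] \<and> s 0 = [] \<and> s 1 = rev (reduction x) \<or> s 7 = [False] \<and> reduction x = [])"
proof -
  have fail: ?thesis
    if "exec BUILD (input x) (1400 * U x) s" "s 7 = [False]" "reduction x = []" for s
    using that by blast
  have success: ?thesis
    if "exec BUILD (input x) (1400 * U x) s" "s 7 = []" "s 0 = []" "s 1 = rev (reduction x)" for s
    using that by blast
  show ?thesis
  proof (cases x rule: unary_cases)
    case 2
    have r: "reduction x = []"
      unfolding reduction_def enc_circuit_eq using unary_not_enc_nat[of "length x"] 2 by auto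
    have 1: "exec (WHILE 0 {B1} (SEQ (POP 0) (PUSH 2 True))) (input x) (4 * length x + 1) (mk [] [] (length x) 0 0 0 [])"
      using exec_read_ones[of "[]" "length x" "[]" 0 0 0 0 "[]"] 2 by (simp add: input_mk)
    have "exec BUILD (input x) (1400 * U x) (mk [] [] (length x) 0 0 0 [False])"
      unfolding BUILD_def by (rule exec_mono[OF exec_seq[OF 1 exec_ifF[OF exec_fail]]]) (auto simp: U_def)
    then show ?thesis by (rule fail) (simp_all add: r)
  next
    case (1 m r)
    let ?N = "length x"
    have m: "m \<le> ?N" and len_r: "length r < ?N" using 1 by (auto simp: enc_nat_def)
    have ones: "exec (WHILE 0 {B1} (SEQ (POP 0) (PUSH 2 True))) (input x) (4 * m + 1) (mk (False # r) [] m 0 0 0 [])"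
      using exec_read_ones[of "False # r" m "[]" 0 0 0 0 "[]"] 1 by (simp add: input_mk enc_nat_def)
    have circ: "x = enc_circuit C \<longleftrightarrow> fst C = m \<and> r = enc_gates (snd C)" for C
      unfolding enc_circuit_eq 1 enc_nat_inj by auto
    have wrap: "exec BUILD (input x) (1400 * U x) s"
      if "exec (IF 2 {B1} (SEQ (SEQ (emit_lin (Lin 1 0 0 7)) emit_prelude)
               (SEQ (PUSH 7 True)
                 (SEQ READ_GATES
                   (IF 7 {B0} SKIP
                     (IF 0 {Bl} (SEQ (emit_gates tail) (EMIT [True, True])) FAIL))))) FAIL)
            (mk r [] m 0 0 0 []) (1390 * U x) s" for s
      unfolding BUILD_def
      by (rule exec_mono[OF exec_seq[OF ones exec_ifT[OF exec_seq[OF exec_popx that]]]])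
        (use m in \<open>auto simp: U_def\<close>)
    show ?thesis
    proof (cases m)
      case 0
      have b: "exec BUILD (input x) (1400 * U x) (mk r [] m 0 0 0 [False])"
        by (rule wrap, rule exec_mono[OF exec_ifF[OF exec_fail]]) (auto simp: U_def 0)
      have "reduction x = []" using circ by (auto simp: reduction_def 0)
      then show ?thesis by (intro fail[OF b]) simp_all
    next
      case (Suc m')
      let ?pre = "enc_nat (m + 7) @ concat (map enc_gate (prelude m))"
      have pre: "exec (SEQ (emit_lin (Lin 1 0 0 7)) emit_prelude) (mk r [] m 0 0 0 []) (320 * U x) (mk r (rev ?pre) m 0 0 0 [])"
      proof -
        have "emits (SEQ (emit_lin (Lin 1 0 0 7)) emit_prelude) m 0 0 0 ?pre (320 * U x)"
          using emits_mono[OF emits_seq[OF emits_lin[OF m le0 le0, of "Lin 1 0 0 7" 0] emits_prelude[OF m]], of "320 * U x"]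
          by (simp add: U_def)
        then have "exec (SEQ (emit_lin (Lin 1 0 0 7)) emit_prelude) (mk r [] m 0 0 0 []) (320 * U x)
            (mk r (rev ?pre @ []) m 0 0 0 [])"
          unfolding emits_def by blast
        then show ?thesis by simp
      qed
      have flag: "exec (PUSH 7 True) (mk r (rev ?pre) m 0 0 0 []) (Suc 0) (mk r (rev ?pre) m 0 0 0 [True])"
        by (rule exec_push) simp
      have rg: "31 * ((length r + 1) * (10 * ?N + 5)) \<le> 31 * U x"
        unfolding U_def using len_r by (intro mult_le_mono2 mult_le_mono1) simp
      have wrap2: "exec BUILD (input x) (1400 * U x) s'"
        if "exec READ_GATES (mk r (rev ?pre) m 0 0 0 [True]) (31 * ((length r + 1) * (10 * ?N + 5))) s"
          "exec (IF 7 {B0} SKIP (IF 0 {Bl} (SEQ (emit_gates tail) (EMIT [True, True])) FAIL)) s (1030 * U x) s'"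
        for s s'
      proof (rule wrap, rule exec_mono[OF exec_ifT[OF exec_seq[OF pre exec_seq[OF flag exec_seq[OF that]]]]])
        have "9 \<le> 9 * U x" by (simp add: U_def)
        then show "Suc (Suc (320 * U x + Suc (Suc 0 + Suc (31 * ((length r + 1) * (10 * ?N + 5)) + 1030 * U x)))) \<le> 1390 * U x"
          using rg by linarith
      qed (simp add: Suc)
      have "length r \<le> ?N" using len_r by simp
      from exec_read_gates[OF m this, of "rev ?pre" 0] show ?thesis
      proof (elim disjE exE conjE)
        fix gs r' assume r: "r = enc_gates gs @ r'"
          and e: "exec READ_GATES (mk r (rev ?pre) m 0 0 0 [True]) (31 * ((length r + 1) * (10 * ?N + 5)))
            (mk r' (rev (concat (map enc_gate (map (shift_gate (4 * m + 13)) gs))) @ rev ?pre) m (0 + length gs) 0 0 [])"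
        let ?out = "rev (concat (map enc_gate (map (shift_gate (4 * m + 13)) gs))) @ rev ?pre"
        show ?thesis
        proof (cases "r' = []")
          case True
          have g: "length gs \<le> ?N"
          proof -
            have "length gs \<le> length (enc_gates gs)"
            proof (induction gs)
              case (Cons g gs)
              then show ?case by (cases g) auto
            qed simp
            then show ?thesis using r len_r by simp
          qed
          have w: "gates_weight tail \<le> 1000" by (simp add: tail_def)
          let ?t = "concat (map (\<lambda>t. enc_gate (inst m (length gs) 0 t)) tail) @ [True, True]"
          have "emits (SEQ (emit_gates tail) (EMIT [True, True])) m (length gs) 0 0 ?t (1020 * U x)"
          proof (rule emits_mono[OF emits_seq[OF emits_gates[OF m g] emits_bits]])
            have "gates_weight tail * (10 * ?N + 5) \<le> 1000 * U x"
              unfolding U_def using w by (intro mult_le_mono) auto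
            moreover have "6 \<le> 20 * U x" by (simp add: U_def)
            ultimately show "Suc (gates_weight tail * (10 * ?N + 5) + (2 * length [True, True] + 1)) \<le> 1020 * U x"
              by simp
          qed simp
          then have "exec (SEQ (emit_gates tail) (EMIT [True, True])) (mk r' ?out m (0 + length gs) 0 0 []) (1020 * U x)
             (mk r' (rev ?t @ ?out) m (length gs) 0 0 [])"
            unfolding emits_def by simp
          then have "exec (IF 7 {B0} SKIP (IF 0 {Bl} (SEQ (emit_gates tail) (EMIT [True, True])) FAIL))
             (mk r' ?out m (0 + length gs) 0 0 []) (1030 * U x) (mk r' (rev ?t @ ?out) m (length gs) 0 0 [])"
            by (intro exec_mono[OF exec_ifF[OF exec_ifT]]) (auto simp: True U_def)
          note b = wrap2[OF e this]
          have x: "x = enc_circuit (m, gs)" using circ[of "(m, gs)"] r True by simp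
          have "reduction x = enc_circuit (reg_circuit (m, gs))"
            unfolding x by (rule reduction_enc) (simp add: Suc)
          also have "\<dots> = rev (rev ?t @ ?out)"
            by (simp add: enc_circuit_def reg_circuit_def comp_def)
          finally show ?thesis by (intro success[OF b]) (simp_all add: True)
        next
          case False
          have "exec (IF 7 {B0} SKIP (IF 0 {Bl} (SEQ (emit_gates tail) (EMIT [True, True])) FAIL))
             (mk r' ?out m (0 + length gs) 0 0 []) (1030 * U x) (mk r' ?out m (0 + length gs) 0 0 [False])"
            by (rule exec_mono[OF exec_ifF[OF exec_ifF[OF exec_fail]]])
              (use False in \<open>auto simp: U_def neq_Nil_conv bit_sym_def split: if_splits\<close>)
          note b = wrap2[OF e this]
          have "r \<noteq> enc_gates hs" for hs
            using enc_gates_inj[of gs r' hs "[]"] False r by simp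
          then have "reduction x = []" unfolding reduction_def using circ by simp
          then show ?thesis by (intro fail[OF b]) simp_all
        qed
      next
        fix s assume no: "\<nexists>gs r'. r = enc_gates gs @ r'"
          and e: "exec READ_GATES (mk r (rev ?pre) m 0 0 0 [True]) (31 * ((length r + 1) * (10 * ?N + 5))) s" "failed m r s"
        have s7: "s 7 = [False]" using e(2) by (auto simp: failed_def)
        have "exec (IF 7 {B0} SKIP (IF 0 {Bl} (SEQ (emit_gates tail) (EMIT [True, True])) FAIL)) s (1030 * U x) s"
          by (rule exec_mono[OF exec_ifT[OF exec.Skip[OF order_refl]]]) (auto simp: s7 U_def)
        note b = wrap2[OF e(1) this]
        have "r \<noteq> enc_gates hs" for hs
          using no by (metis append_Nil2)
        then have "reduction x = []" unfolding reduction_def using circ by simp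
        then show ?thesis by (intro fail[OF b s7])
      qed
    qed
  qed
qed

definition MOVE :: com where
  "MOVE = WHILE 1 {B0, B1} (IF 1 {B1} (SEQ (POP 1) (PUSH 0 True)) (SEQ (POP 1) (PUSH 0 False)))"

lemma exec_move:
  "s 1 = out \<Longrightarrow> exec MOVE s (5 * length out + 1) (s(1 := [], 0 := rev out @ s 0))"
proof (induction out arbitrary: s)
  case Nil
  then show ?case unfolding MOVE_def by (auto intro!: exec_whileF simp: fun_eq_iff)
next
  case (Cons b out)
  let ?s = "s(1 := out, 0 := b # s 0)"
  have push: "exec (SEQ (POP 1) (PUSH 0 b)) s 3 ?s"
    by (rule exec_mono[OF exec_seq[OF exec_pop[OF refl] exec_push]]) (use Cons.prems in \<open>auto simp: fun_eq_iff\<close>)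
  have body: "exec (IF 1 {B1} (SEQ (POP 1) (PUSH 0 True)) (SEQ (POP 1) (PUSH 0 False))) s (Suc 3) ?s"
  proof (cases b)
    case True
    then show ?thesis using push Cons.prems by (intro exec_ifT) simp_all
  next
    case False
    then show ?thesis using push Cons.prems by (intro exec_ifF) simp_all
  qed
  have "?s(1 := [], 0 := rev out @ ?s 0) = s(1 := [], 0 := rev (b # out) @ s 0)"
    by (auto simp: fun_eq_iff)
  moreover have "?s 1 = out" by simp
  ultimately have rest: "exec MOVE ?s (5 * length out + 1) (s(1 := [], 0 := rev (b # out) @ s 0))"
    using Cons.IH[of ?s] by (simp only:)
  have "top (s 1) \<in> {B0, B1}" using Cons.prems by (simp add: bit_sym_def)
  from exec_whileT[OF body rest[unfolded MOVE_def] this] show ?case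
    unfolding MOVE_def by (rule exec_mono) simp
qed

definition CLEAR :: com where
  "CLEAR = WHILE 0 {B0, B1} (POP 0)"

lemma exec_clear: "s 0 = y \<Longrightarrow> exec CLEAR s (2 * length y + 1) (s(0 := []))"
proof (induction y arbitrary: s)
  case Nil
  then show ?case unfolding CLEAR_def by (auto intro!: exec_whileF simp: fun_eq_iff)
next
  case (Cons b y)
  have body: "exec (POP 0) s (Suc 0) (s(0 := y))" by (rule exec_pop) (simp add: Cons.prems)
  have rest: "exec CLEAR (s(0 := y)) (2 * length y + 1) (s(0 := []))"
    using Cons.IH[of "s(0 := y)", OF fun_upd_same] by (simp only: fun_upd_upd)
  have "top (s 0) \<in> {B0, B1}" using Cons.prems by (simp add: bit_sym_def)
  from exec_whileT[OF body rest[unfolded CLEAR_def] this] show ?case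
    unfolding CLEAR_def by (rule exec_mono) simp
qed

text \<open>After a failure stack 1 holds a partial output. Only stack 0 is the output of the
  machine, so emptying that stack yields the empty string.\<close>

definition PROGRAM :: com where
  "PROGRAM = SEQ BUILD (IF 7 {B0} CLEAR MOVE)"

lemma com_wf_rep: "com_wf K c \<Longrightarrow> com_wf K (REP n c)"
  by (induction n) auto

lemma com_wf_bits: "1 < K \<Longrightarrow> com_wf K (EMIT bs)"
  by (induction bs) auto

lemma com_wf_emit_lin: "com_wf 8 (emit_lin l)"
  by (cases l) (auto simp: COPY_def intro!: com_wf_rep)

lemma com_wf_emit_gate: "com_wf 8 (emit_gate t)"
  by (cases t) (auto simp: com_wf_emit_lin simp del: EMIT.simps intro!: com_wf_bits)

lemma com_wf_emit_gates: "com_wf 8 (emit_gates ts)"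
  by (induction ts) (auto simp: com_wf_emit_gate)

lemma com_wf_loop: "com_wf 8 c \<Longrightarrow> com_wf 8 (LOOP c)"
  by (simp add: LOOP_def COPY_def)

lemma com_wf_fail: "com_wf 8 FAIL"
  by (simp add: FAIL_def)

lemma com_wf_pass: "com_wf 8 PASS"
  unfolding PASS_def com_wf.simps by (intro conjI com_wf_rep com_wf_fail) (simp_all add: COPY_def)

lemma com_wf_read_gates: "com_wf 8 READ_GATES"
  by (simp add: READ_GATES_def READ_GATE_def READ1_def READ2_def com_wf_pass com_wf_fail com_wf_bits
      del: EMIT.simps)

lemma com_wf_build: "com_wf 8 BUILD"
  by (simp add: BUILD_def emit_prelude_def com_wf_read_gates com_wf_fail com_wf_bits com_wf_emit_lin
      com_wf_emit_gate com_wf_emit_gates com_wf_loop del: EMIT.simps emit_lin.simps)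

lemma com_wf_program: "com_wf 8 PROGRAM"
  by (simp add: PROGRAM_def com_wf_build CLEAR_def MOVE_def)

lemma length_stack_le: "i < K \<Longrightarrow> length (s i) \<le> length (tape K s)"
  by (simp add: tape_split)

theorem poly_time_reduction: "poly_time_computable reduction"
proof (rule poly_time_computable_exec[OF com_wf_program])
  fix x :: "bool list"
  define U where "U = (length x + 1) * (10 * length x + 5)"
  have U: "1 \<le> U" "length x \<le> U" "U \<le> 10 * Suc (length x) ^ 2"
    by (simp_all add: U_def power2_eq_square algebra_simps)
  obtain s where b: "exec BUILD (input x) (1400 * U) s"
    and s: "s 7 = [] \<and> s 0 = [] \<and> s 1 = rev (reduction x) \<or> s 7 = [False] \<and> reduction x = []"
    using exec_build[of x] unfolding U_def by blast
  have "length (tape 8 s) \<le> length x + 8 + 1400 * U"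
    using exec_length_tape[OF b com_wf_build] by (simp add: tape_input)
  \<comment> \<open>Stack lengths are bounded by the time spent: 1409 is 1400 plus 1 for the input
    and 8 for the terminators.\<close>
  then have len: "length (s i) \<le> 1409 * U" if "i < 8" for i
    using length_stack_le[OF that, of s] U by linarith
  \<comment> \<open>\<open>MOVE\<close> takes 5 steps per bit, and 5 * 1409 U with its overhead
    stays below 7050 U. The factor from 8500 to 85000 comes from the bound of U by 10 times a
    square.\<close>
  have finish: "\<exists>s'. exec PROGRAM (input x) (85000 * Suc (length x) ^ 2) s' \<and> s' 0 = reduction x"
    if "exec (IF 7 {B0} CLEAR MOVE) s (7050 * U) s'" "s' 0 = reduction x" for s'
  proof -
    have "Suc (1400 * U + 7050 * U) \<le> 8500 * U" using U(1) by simp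
    also have "\<dots> \<le> 85000 * Suc (length x) ^ 2" using U(3) by simp
    finally show ?thesis
      unfolding PROGRAM_def using exec_mono[OF exec_seq[OF b that(1)]] that(2) by blast
  qed
  from s show "\<exists>s. exec PROGRAM (input x) (85000 * Suc (length x) ^ 2) s \<and> s 0 = reduction x"
  proof
    assume s: "s 7 = [] \<and> s 0 = [] \<and> s 1 = rev (reduction x)"
    have "exec (IF 7 {B0} CLEAR MOVE) s (7050 * U) (s(1 := [], 0 := rev (s 1) @ s 0))"
      by (rule exec_mono[OF exec_ifF[OF exec_move[OF refl]]]) (use s len[of 1] U(1) in auto)
    then show ?thesis by (rule finish) (use s in simp)
  next
    assume s: "s 7 = [False] \<and> reduction x = []"
    have "exec (IF 7 {B0} CLEAR MOVE) s (7050 * U) (s(0 := []))"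
      by (rule exec_mono[OF exec_ifT[OF exec_clear[OF refl]]]) (use s len[of 0] U(1) in auto)
    then show ?thesis by (rule finish) (use s in simp)
  qed
qed simp

theorem theorem1:
  shows "karp_reducible CIRCUIT_SAT FSR_IRREDUCIBILITY"
  unfolding karp_reducible_def using poly_time_reduction reduction_correct by blast

end
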